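(* Let $v\in\mathcal H^J\cap\bigcap_{|t|<\pi/2}\mathcal D(e^{tA})$. The following are equivalent: (a) $v\in\mathcal H^J_{\rm temp}$; (b) both limits $\lim_{t\to\pm\pi/2}e^{tA}v$ exist in $\mathcal H^{-\infty}$ (weak-$*$ topology); (c) there exist $C,N>0$ such that $\|e^{\pm tA}v\|^2\le C\,(\tfrac{\pi}{2}-|t|)^{-N}$ for all $|t|<\pi/2$.
   Context: Let $\mathcal H$ be a complex Hilbert space (inner product linear in the second argument), $A$ a selfadjoint operator with spectral measure $P$, $U_t=e^{itA}$, and $J$ an antiunitary involution commuting with all $U_t$; $\mathcal H^J=\{v:Jv=v\}$. For $v\in\mathcal H$ let $P^v=\langle v,P(\cdot)v\rangle$. A positive Borel measure $\mu$ on $\mathbb R$ is tempered if $\int(1+p^2)^{-N}d\mu(p)<\infty$ for some $N$. Put $\mathcal H^J_{\rm temp}=\{v\in\mathcal H^J: e^{\pi p}\,dP^v(p)\text{ is tempered}\}$. $\mathcal H^\infty=\bigcap_n\mathcal D(A^n)$ with its Fréchet topology, $\mathcal H^{-\infty}$ the space of continuous antilinear functionals on $\mathcal H^\infty$ with weak-$*$ topology, and $\mathcal H\subset\mathcal H^{-\infty}$ via $w\mapsto\langle\cdot,w\rangle$. *)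

theory Defs
  imports "HOL-Analysis.Analysis"
begin

class chilbert = real_normed_vector + complete_space +
  fixes scaleC :: "complex \<Rightarrow> 'a \<Rightarrow> 'a"
    and cinner :: "'a \<Rightarrow> 'a \<Rightarrow> complex"
  assumes scaleC_of_real: "scaleC (complex_of_real r) x = scaleR r x"
    and scaleC_add_right: "scaleC a (x + y) = scaleC a x + scaleC a y"
    and scaleC_add_left: "scaleC (a + b) x = scaleC a x + scaleC b x"
    and scaleC_scaleC: "scaleC a (scaleC b x) = scaleC (a * b) x"
    and scaleC_one: "scaleC 1 x = x"
    and cinner_add_right: "cinner x (y + z) = cinner x y + cinner x z"
    and cinner_scaleC_right: "cinner x (scaleC a y) = a * cinner x y"
    and cinner_commute: "cinner y x = cnj (cinner x y)"
    and cinner_pos: "Re (cinner x x) \<ge> 0" "Im (cinner x x) = 0"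
    and cinner_eq_zero: "cinner x x = 0 \<longleftrightarrow> x = 0"
    and norm_cinner: "norm x = sqrt (Re (cinner x x))"

definition clinear :: "('a::chilbert \<Rightarrow> 'a) \<Rightarrow> bool" where
  "clinear T \<longleftrightarrow> (\<forall>x y. T (x + y) = T x + T y) \<and> (\<forall>a x. T (scaleC a x) = scaleC a (T x))"

definition is_pvm :: "(real set \<Rightarrow> 'a::chilbert \<Rightarrow> 'a) \<Rightarrow> bool" where
  "is_pvm P \<longleftrightarrow>
     (\<forall>E \<in> sets borel. clinear (P E) \<and> (\<forall>x y. cinner x (P E y) = cinner (P E x) y)
                        \<and> (\<forall>x. P E (P E x) = P E x)) \<and>
     (\<forall>x. P UNIV x = x) \<and>
     (\<forall>E \<in> sets borel. \<forall>F \<in> sets borel. \<forall>x. P (E \<inter> F) x = P E (P F x)) \<and>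
     (\<forall>En. range En \<subseteq> sets borel \<longrightarrow> disjoint_family En \<longrightarrow>
        (\<forall>x. (\<lambda>n. \<Sum>k<n. P (En k) x) \<longlonglongrightarrow> P (\<Union>k. En k) x))"

definition spec_meas :: "(real set \<Rightarrow> 'a::chilbert \<Rightarrow> 'a) \<Rightarrow> 'a \<Rightarrow> real measure" where
  "spec_meas P v = measure_of UNIV (sets borel) (\<lambda>E. ennreal (Re (cinner v (P E v))))"

text \<open>Bounded functional calculus: \<open>\<langle>w, f(P) v\<rangle> = \<integral> f dP^{w,v}\<close>, the complex measure
  \<open>P^{w,v}\<close> being written by polarization.\<close>
definition bcalc :: "(real set \<Rightarrow> 'a::chilbert \<Rightarrow> 'a) \<Rightarrow> (real \<Rightarrow> complex) \<Rightarrow> 'a \<Rightarrow> 'a" where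
  "bcalc P f v = (THE x. \<forall>w. cinner w x =
      (\<Sum>k<4::nat. (\<i> ^ k / 4) * integral\<^sup>L (spec_meas P (scaleC (\<i> ^ k) w + v)) f))"

definition fdom :: "(real set \<Rightarrow> 'a::chilbert \<Rightarrow> 'a) \<Rightarrow> (real \<Rightarrow> complex) \<Rightarrow> 'a set" where
  "fdom P f = {v. integral\<^sup>N (spec_meas P v) (\<lambda>p. ennreal ((cmod (f p))\<^sup>2)) < \<infinity>}"

definition fcalc :: "(real set \<Rightarrow> 'a::chilbert \<Rightarrow> 'a) \<Rightarrow> (real \<Rightarrow> complex) \<Rightarrow> 'a \<Rightarrow> 'a" where
  "fcalc P f v = lim (\<lambda>n::nat. bcalc P (\<lambda>p. f p * indicator {p. cmod (f p) \<le> real n} p) v)"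

definition opA :: "(real set \<Rightarrow> 'a::chilbert \<Rightarrow> 'a) \<Rightarrow> 'a \<Rightarrow> 'a" where
  "opA P = fcalc P (\<lambda>p. complex_of_real p)"

definition domA :: "(real set \<Rightarrow> 'a::chilbert \<Rightarrow> 'a) \<Rightarrow> 'a set" where
  "domA P = fdom P (\<lambda>p. complex_of_real p)"

fun domApow :: "(real set \<Rightarrow> 'a::chilbert \<Rightarrow> 'a) \<Rightarrow> nat \<Rightarrow> 'a set" where
  "domApow P 0 = UNIV"
| "domApow P (Suc n) = {v \<in> domA P. opA P v \<in> domApow P n}"

definition smooth_vecs :: "(real set \<Rightarrow> 'a::chilbert \<Rightarrow> 'a) \<Rightarrow> 'a set" where
  "smooth_vecs P = (\<Inter>n. domApow P n)"

definition Ugrp :: "(real set \<Rightarrow> 'a::chilbert \<Rightarrow> 'a) \<Rightarrow> real \<Rightarrow> 'a \<Rightarrow> 'a" where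
  "Ugrp P t = fcalc P (\<lambda>p. exp (\<i> * complex_of_real (t * p)))"

definition expA :: "(real set \<Rightarrow> 'a::chilbert \<Rightarrow> 'a) \<Rightarrow> real \<Rightarrow> 'a \<Rightarrow> 'a" where
  "expA P t = fcalc P (\<lambda>p. complex_of_real (exp (t * p)))"

definition dom_expA :: "(real set \<Rightarrow> 'a::chilbert \<Rightarrow> 'a) \<Rightarrow> real \<Rightarrow> 'a set" where
  "dom_expA P t = fdom P (\<lambda>p. complex_of_real (exp (t * p)))"

definition antiunitary_involution :: "('a::chilbert \<Rightarrow> 'a) \<Rightarrow> bool" where
  "antiunitary_involution J \<longleftrightarrow>
     (\<forall>x y. J (x + y) = J x + J y) \<and> (\<forall>a x. J (scaleC a x) = scaleC (cnj a) (J x)) \<and>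
     (\<forall>x y. cinner (J x) (J y) = cnj (cinner x y)) \<and> (\<forall>x. J (J x) = x)"

definition tempered :: "real measure \<Rightarrow> bool" where
  "tempered \<mu> \<longleftrightarrow> (\<exists>N::nat. integral\<^sup>N \<mu> (\<lambda>p. ennreal ((1 + p\<^sup>2) powr (- real N))) < \<infinity>)"

definition HJ_temp :: "(real set \<Rightarrow> 'a::chilbert \<Rightarrow> 'a) \<Rightarrow> ('a \<Rightarrow> 'a) \<Rightarrow> 'a set" where
  "HJ_temp P J = {v. J v = v \<and> tempered (density (spec_meas P v) (\<lambda>p. ennreal (exp (pi * p))))}"

text \<open>Continuity on the Fr\'echet space \<open>H^\<infinity>\<close> (seminorms \<open>\<parallel>A^k v\<parallel>\<close>) for a (semi)linear map
  means domination by finitely many seminorms.\<close>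
definition distr_vecs :: "(real set \<Rightarrow> 'a::chilbert \<Rightarrow> 'a) \<Rightarrow> ('a \<Rightarrow> complex) set" where
  "distr_vecs P = {\<phi>.
     (\<forall>x \<in> smooth_vecs P. \<forall>y \<in> smooth_vecs P. \<phi> (x + y) = \<phi> x + \<phi> y) \<and>
     (\<forall>a. \<forall>x \<in> smooth_vecs P. \<phi> (scaleC a x) = cnj a * \<phi> x) \<and>
     (\<exists>n C. \<forall>x \<in> smooth_vecs P. cmod (\<phi> x) \<le> C * (\<Sum>k\<le>n. norm ((opA P ^^ k) x)))}"

text \<open>\<open>f(t) \<rightarrow> \<phi>\<close> in \<open>H^{-\<infinity>}\<close> (weak-* topology), vectors being embedded via \<open>w \<mapsto> \<langle>\<cdot>, w\<rangle>\<close>.\<close>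
definition distr_limit ::
  "(real set \<Rightarrow> 'a::chilbert \<Rightarrow> 'a) \<Rightarrow> (real \<Rightarrow> 'a) \<Rightarrow> real filter \<Rightarrow> bool" where
  "distr_limit P f F \<longleftrightarrow> (\<exists>\<phi> \<in> distr_vecs P.
      \<forall>w \<in> smooth_vecs P. ((\<lambda>t. cinner w (f t)) \<longlongrightarrow> \<phi> w) F)"

end

theory Submission
  imports Defs "HOL-Probability.Levy"
begin

text \<open>
  Everything reduces to the finite measure \<open>\<mu> = P\<^sup>v\<close>: \<open>\<parallel>e\<^bsup>tA\<^esup> v\<parallel>\<^sup>2 = \<integral> e\<^bsup>2tp\<^esup> d\<mu>\<close>, and \<open>\<mu>\<close> is invariant under
  \<open>p \<mapsto> -p\<close> because \<open>\<langle>v, U\<^sub>t v\<rangle>\<close>, its Fourier transform, is real when \<open>Jv = v\<close>. So temperedness of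
  \<open>e\<^bsup>\<pi>p\<^esup> d\<mu>\<close> controls both tails, which gives the growth bound (c) and, with \<open>(1 + A\<^sup>2)\<^bsup>-N\<^esup> e\<^bsup>tA\<^esup> v\<close>
  convergent in norm, the limits (b). Conversely, (c) yields temperedness by summation over
  \<open>t = \<pi>/2 - 1/n\<close>, and (b) by testing the limit functional, which is dominated by finitely many
  seminorms, against spectral cut-offs of \<open>(1 + A\<^sup>2)\<^bsup>-n\<^esup> e\<^bsup>\<pi>A/2\<^esup> v\<close>.
\<close>

section \<open>Complex inner products\<close>

text \<open>\<open>bcalc\<close> is a definite description and \<open>fcalc\<close> a
  \<open>lim\<close>, so neither says anything about A until representing vectors exist and
  truncations converge. Existence comes from completeness: projections represent indicators, and the
  isometry between f in L^2(P^v) and f(P) v turns bounded pointwise limits into Cauchy sequences.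
  Identities for unbounded functions are tested on spectral cut-offs, where every operator is
  bounded.

  The exponent pi is twice the endpoint pi/2, since squaring the norm doubles t. At the endpoint
  e^(pi p) need not be P^v-integrable, so no limit in H can be expected; the missing factor (1 +
  p^2)^(-N) is what continuity in the seminorms \<open>norm ((opA P ^^ k) w)\<close> can pay for,
  with (1 + A^2)^N acting on the test vector. In the converse direction the test vector is built
  from v itself, so that the value of the functional and the seminorms are governed by the same
  integral.\<close>

lemma scaleC_minus_one: "scaleC (- 1) x = - (x :: 'a::chilbert)"
  using scaleC_of_real[of "- 1" x] by simp

lemma cinner_add_left: "cinner (x + y) z = cinner x z + cinner (y :: 'a::chilbert) z"
  by (metis cinner_add_right cinner_commute complex_cnj_add)

lemma cinner_scaleC_left: "cinner (scaleC a x) y = cnj a * cinner (x :: 'a::chilbert) y"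
  by (metis cinner_scaleC_right cinner_commute complex_cnj_mult)

lemma cinner_minus_right: "cinner x (- y) = - cinner (x :: 'a::chilbert) y"
  using cinner_scaleC_right[of x "- 1" y] by (simp add: scaleC_minus_one)

lemma cinner_minus_left: "cinner (- x) y = - cinner (x :: 'a::chilbert) y"
  using cinner_scaleC_left[of "- 1" x y] by (simp add: scaleC_minus_one)

lemma cinner_diff_right: "cinner x (y - z) = cinner x y - cinner (x :: 'a::chilbert) z"
  using cinner_add_right[of x y "- z"] by (simp add: cinner_minus_right)

lemma cinner_diff_left: "cinner (x - y) z = cinner x z - cinner (y :: 'a::chilbert) z"
  using cinner_add_left[of x "- y" z] by (simp add: cinner_minus_left)

lemma cinner_zero_right [simp]: "cinner x (0 :: 'a::chilbert) = 0"
  using cinner_diff_right[of x 0 0] by simp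

lemma cinner_zero_left [simp]: "cinner (0 :: 'a::chilbert) x = 0"
  using cinner_diff_left[of 0 0 x] by simp

lemma cinner_self: "cinner x x = complex_of_real ((norm (x :: 'a::chilbert))\<^sup>2)"
  using cinner_pos[of x] by (simp add: complex_eq_iff norm_cinner)

text \<open>Orthogonal decomposition of x along y: c is the coefficient of the projection of x onto
  the line of y, and Pythagoras bounds that projection by \<open>norm x\<close>.\<close>

lemma cinner_cauchy_schwarz: "cmod (cinner x y) \<le> norm x * norm (y :: 'a::chilbert)"
proof (cases "y = 0")
  case False
  define c where "c = cinner y x / complex_of_real ((norm y)\<^sup>2)"
  define z where "z = x - scaleC c y"
  have ny: "norm y \<noteq> 0" using False by simp
  have yz: "cinner y z = 0"
    using ny by (simp add: z_def cinner_diff_right cinner_scaleC_right c_def cinner_self)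
  have "cinner x x = cinner z z + cnj c * c * cinner y y"
  proof -
    have x: "x = z + scaleC c y" by (simp add: z_def)
    have zy: "cinner z y = 0" using yz by (metis cinner_commute complex_cnj_zero)
    show ?thesis
      by (subst (1 2) x) (simp add: cinner_add_left cinner_add_right cinner_scaleC_left
          cinner_scaleC_right yz zy)
  qed
  also have "cnj c * c = complex_of_real ((cmod c)\<^sup>2)"
    by (simp only: complex_norm_square mult.commute)
  finally have "complex_of_real ((norm x)\<^sup>2)
      = complex_of_real ((norm z)\<^sup>2 + (cmod c)\<^sup>2 * (norm y)\<^sup>2)"
    by (simp add: cinner_self)
  then have "(norm x)\<^sup>2 = (norm z)\<^sup>2 + (cmod c)\<^sup>2 * (norm y)\<^sup>2"
    by (simp only: of_real_eq_iff)
  then have "(cmod c * norm y)\<^sup>2 \<le> (norm x)\<^sup>2" by (simp add: power_mult_distrib)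
  then have "cmod c * norm y \<le> norm x" by (rule power2_le_imp_le) simp
  moreover have "cmod c * norm y = cmod (cinner y x) / norm y"
    using ny by (simp add: c_def norm_divide norm_mult power2_eq_square)
  ultimately have "cmod (cinner y x) \<le> norm x * norm y"
    using ny by (simp add: divide_le_eq split: if_splits)
  then show ?thesis by (metis cinner_commute complex_mod_cnj)
qed simp

lemma tendsto_cinner_right:
  assumes "(f \<longlongrightarrow> y) F" shows "((\<lambda>n. cinner x (f n)) \<longlongrightarrow> cinner (x :: 'a::chilbert) y) F"
proof (rule Lim_null_comparison[THEN LIM_zero_cancel])
  show "((\<lambda>n. norm x * norm (f n - y)) \<longlongrightarrow> 0) F"
    using assms by (intro tendsto_mult_right_zero tendsto_norm_zero LIM_zero)
  show "\<forall>\<^sub>F n in F. norm (cinner x (f n) - cinner x y) \<le> norm x * norm (f n - y)"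
    by (simp add: cinner_diff_right [symmetric] cinner_cauchy_schwarz)
qed

lemma cinner_ext:
  assumes "\<And>w. cinner w x = cinner w (y :: 'a::chilbert)" shows "x = y"
proof -
  have "cinner (x - y) (x - y) = 0"
    using assms[of "x - y"] by (simp add: cinner_diff_right)
  then show ?thesis by (simp add: cinner_eq_zero)
qed

section \<open>Bounded Borel functions\<close>

definition bounded_borel :: "(real \<Rightarrow> complex) \<Rightarrow> bool" where
  "bounded_borel f \<longleftrightarrow> f \<in> borel_measurable borel \<and> (\<exists>K. \<forall>x. cmod (f x) \<le> K)"

lemma bounded_borelI:
  "f \<in> borel_measurable borel \<Longrightarrow> (\<And>x. cmod (f x) \<le> K) \<Longrightarrow> bounded_borel f"
  by (auto simp: bounded_borel_def)

lemma bounded_borel_measurable: "bounded_borel f \<Longrightarrow> f \<in> borel_measurable borel"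
  by (simp add: bounded_borel_def)

lemma bounded_borel_indicator: "E \<in> sets borel \<Longrightarrow> bounded_borel (indicator E)"
  by (rule bounded_borelI[where K = 1]) (auto simp: indicator_def)

lemma bounded_borel_const: "bounded_borel (\<lambda>_. c)"
  by (rule bounded_borelI[where K = "cmod c"]) auto

lemma bounded_borel_add:
  assumes "bounded_borel f" "bounded_borel g" shows "bounded_borel (\<lambda>x. f x + g x)"
proof -
  from assms obtain K L where "\<And>x. cmod (f x) \<le> K" "\<And>x. cmod (g x) \<le> L"
    by (auto simp: bounded_borel_def)
  then have "cmod (f x + g x) \<le> K + L" for x
    by (meson add_mono norm_triangle_le)
  then show ?thesis using assms by (intro bounded_borelI) (auto simp: bounded_borel_def)
qed

lemma bounded_borel_mult:
  assumes "bounded_borel f" "bounded_borel g" shows "bounded_borel (\<lambda>x. f x * g x)"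
proof -
  from assms obtain K L where "\<And>x. cmod (f x) \<le> K" "\<And>x. cmod (g x) \<le> L"
    by (auto simp: bounded_borel_def)
  then have "cmod (f x * g x) \<le> K * L" for x
    unfolding norm_mult by (meson mult_mono norm_ge_zero order_trans)
  then show ?thesis using assms by (intro bounded_borelI) (auto simp: bounded_borel_def)
qed

lemma bounded_borel_cnj: "bounded_borel f \<Longrightarrow> bounded_borel (\<lambda>x. cnj (f x))"
  by (auto simp: bounded_borel_def intro: borel_measurable_continuous_on[of cnj]
      continuous_intros)

lemma bounded_borel_diff:
  assumes "bounded_borel f" "bounded_borel g" shows "bounded_borel (\<lambda>x. f x - g x)"
  using bounded_borel_add[OF assms(1) bounded_borel_mult[OF bounded_borel_const[of "- 1"] assms(2)]]
  by simp

lemmas bounded_borel_intros = bounded_borel_indicator bounded_borel_const bounded_borel_add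
  bounded_borel_mult bounded_borel_cnj bounded_borel_diff

text \<open>Indicators, sums and multiples give the simple functions, which approximate f pointwise.
  The case \<open>lim\<close> hands over a common bound K because constants dominate on finite
  measures; an identity linear in f and stable under dominated convergence then has to be checked on
  indicators only.\<close>

lemma bounded_borel_induct [consumes 1, case_names indicator add scale lim]:
  assumes f: "bounded_borel f"
    and ind: "\<And>E. E \<in> sets borel \<Longrightarrow> Q (indicator E)"
    and add: "\<And>f g. bounded_borel f \<Longrightarrow> bounded_borel g \<Longrightarrow> Q f \<Longrightarrow> Q g \<Longrightarrow> Q (\<lambda>x. f x + g x)"
    and scale: "\<And>c f. bounded_borel f \<Longrightarrow> Q f \<Longrightarrow> Q (\<lambda>x. c * f x)"
    and lim: "\<And>s f K. (\<And>n. s n \<in> borel_measurable borel) \<Longrightarrow> f \<in> borel_measurable borel \<Longrightarrow>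
       (\<And>n x. cmod (s n x) \<le> K) \<Longrightarrow> (\<And>x. cmod (f x) \<le> K) \<Longrightarrow>
       (\<And>n. Q (s n)) \<Longrightarrow> (\<And>x. (\<lambda>n. s n x) \<longlonglongrightarrow> f x) \<Longrightarrow> Q f"
  shows "Q f"
proof -
  have simple: "Q s" if s: "simple_function borel s" for s :: "real \<Rightarrow> complex"
  proof -
    have fin: "finite (range s)" using s by (simp add: simple_function_def)
    have meas: "s -` {y} \<in> sets borel" for y
      using measurable_sets[OF borel_measurable_simple_function[OF s], of "{y}"] by simp
    have "bounded_borel (\<lambda>x. \<Sum>y\<in>Y. y * indicator (s -` {y}) x)
        \<and> Q (\<lambda>x. \<Sum>y\<in>Y. y * indicator (s -` {y}) x)" if "finite Y" for Y
      using that
    proof induction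
      case empty
      have "Q (indicator {})" by (rule ind) simp
      moreover have "indicator {} = (\<lambda>x::real. 0::complex)" by auto
      ultimately show ?case using bounded_borel_const[of 0] by simp
    next
      case (insert y Y)
      then show ?case
        by (simp del: sum_mult_indicator sum_indicator_mult
            add: add scale ind bounded_borel_intros meas)
    qed
    from this[OF fin] have "Q (\<lambda>x. \<Sum>y\<in>range s. y * indicator (s -` {y}) x)" ..
    also have "(\<lambda>x. \<Sum>y\<in>range s. y * indicator (s -` {y}) x) = s"
    proof
      fix x
      have "(\<Sum>y\<in>range s. y * indicator (s -` {y}) x) = (\<Sum>y\<in>range s. if y = s x then s x else 0)"
        by (rule sum.cong) (auto simp: indicator_def)
      also have "\<dots> = s x" using fin by simp
      finally show "(\<Sum>y\<in>range s. y * indicator (s -` {y}) x) = s x" .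
    qed
    finally show ?thesis .
  qed
  from f obtain K where K: "\<And>x. cmod (f x) \<le> K" and m: "f \<in> borel_measurable borel"
    by (auto simp: bounded_borel_def)
  from borel_measurable_implies_sequence_metric[OF m, of 0] obtain s where
    s: "\<And>i. simple_function borel (s i)" "\<And>x. (\<lambda>i. s i x) \<longlonglongrightarrow> f x"
       "\<And>i x. norm (s i x) \<le> 2 * norm (f x)"
    by auto
  show ?thesis
  \<comment> \<open>The approximation only satisfies norm (s i x) <= 2 * norm (f x), hence the bound
    2 * K.\<close>
  proof (rule lim[of s f "2 * K"])
    show "cmod (s n x) \<le> 2 * K" for n x using s(3)[of n x] K[of x] by simp
    show "cmod (f x) \<le> 2 * K" for x using norm_ge_zero[of "f x"] K[of x] by linarith
  qed (use s m simple in \<open>auto intro: borel_measurable_simple_function\<close>)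
qed

section \<open>Functional calculus of a projection-valued measure\<close>

text \<open>The integral of f against the complex measure <w, P(.) v>, as it stands in
  \<open>bcalc\<close>. The factor \<open>\<i> ^ k\<close> sits on w because the inner product is
  antilinear in its first argument.\<close>

definition polarized_integral ::
    "(real set \<Rightarrow> 'a::chilbert \<Rightarrow> 'a) \<Rightarrow> (real \<Rightarrow> complex) \<Rightarrow> 'a \<Rightarrow> 'a \<Rightarrow> complex" where
  "polarized_integral P f w v =
    (\<Sum>k<4::nat. (\<i> ^ k / 4) * integral\<^sup>L (spec_meas P (scaleC (\<i> ^ k) w + v)) f)"

lemma sum_lessThan_4: "(\<Sum>k<4::nat. h k) = h 0 + h 1 + h 2 + (h 3 :: complex)"
  by (simp add: eval_nat_numeral)

lemma cinner_sum_right: "cinner x (\<Sum>k\<in>A. f k) = (\<Sum>k\<in>A. cinner (x::'a::chilbert) (f k))"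
  by (induction A rule: infinite_finite_induct) (simp_all add: cinner_add_right)

locale pvm =
  fixes P :: "real set \<Rightarrow> 'a::chilbert \<Rightarrow> 'a"
  assumes pvm: "is_pvm P"
begin

lemma P_props: "E \<in> sets borel \<Longrightarrow> clinear (P E) \<and> (\<forall>x y. cinner x (P E y) = cinner (P E x) y)
    \<and> (\<forall>x. P E (P E x) = P E x)"
  using pvm unfolding is_pvm_def by (elim conjE) (rule bspec)

lemma P_add: "E \<in> sets borel \<Longrightarrow> P E (x + y) = P E x + P E y"
  and P_scaleC: "E \<in> sets borel \<Longrightarrow> P E (scaleC a x) = scaleC a (P E x)"
  and P_sym: "E \<in> sets borel \<Longrightarrow> cinner x (P E y) = cinner (P E x) y"
  and P_idem: "E \<in> sets borel \<Longrightarrow> P E (P E x) = P E x"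
  using P_props unfolding clinear_def by metis+

lemma P_UNIV: "P UNIV x = x"
  using pvm unfolding is_pvm_def by (elim conjE) (rule spec)

lemma P_Int: "E \<in> sets borel \<Longrightarrow> F \<in> sets borel \<Longrightarrow> P (E \<inter> F) x = P E (P F x)"
  using pvm unfolding is_pvm_def by (elim conjE) simp

lemma P_sums:
  assumes "range En \<subseteq> sets borel" "disjoint_family En"
  shows "(\<lambda>n. \<Sum>k<n. P (En k) x) \<longlonglongrightarrow> P (\<Union>k. En k) x"
proof -
  have "\<forall>En. range En \<subseteq> sets borel \<longrightarrow> disjoint_family En \<longrightarrow>
      (\<forall>x. (\<lambda>n. \<Sum>k<n. P (En k) x) \<longlonglongrightarrow> P (\<Union>k. En k) x)"
    using pvm unfolding is_pvm_def by (elim conjE)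
  from this[rule_format, OF assms] show ?thesis .
qed

lemma P_minus: "E \<in> sets borel \<Longrightarrow> P E (- x) = - P E x"
  using P_scaleC[of E "- 1" x] by (simp add: scaleC_minus_one)

lemma P_diff: "E \<in> sets borel \<Longrightarrow> P E (x - y) = P E x - P E y"
  using P_add[of E x "- y"] by (simp add: P_minus)

lemma P_empty: "P {} x = 0"
proof -
  have "(\<lambda>n. \<Sum>k<n. P {} x) \<longlonglongrightarrow> P {} x"
    using P_sums[of "\<lambda>_. {}" x] by (auto simp: disjoint_family_on_def)
  then have "summable (\<lambda>k::nat. P {} x)"
    by (auto simp: summable_def sums_def)
  then show ?thesis by (simp add: summable_const_iff)
qed

lemma cinner_P: "E \<in> sets borel \<Longrightarrow> cinner v (P E v) = complex_of_real ((norm (P E v))\<^sup>2)"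
  by (metis P_idem P_sym cinner_self)

section \<open>Spectral measures of single vectors\<close>

lemma sets_spec_meas [measurable_cong, simp]: "sets (spec_meas P v) = sets borel"
  unfolding spec_meas_def
  by (simp add: sigma_algebra.sets_measure_of_eq[OF sets.sigma_algebra_axioms[of borel, simplified]])

lemma space_spec_meas [simp]: "space (spec_meas P v) = UNIV"
  unfolding spec_meas_def by (simp add: space_measure_of_conv)

text \<open>\<open>measure_of\<close> has the prescribed values only for a countably additive set
  function; additivity is the strong convergence of the partial sums, paired with v. The squared
  norm equals <v, P E v> since P E is a symmetric idempotent, and makes positivity evident.\<close>

lemma emeasure_spec_meas:
  assumes "E \<in> sets borel" shows "emeasure (spec_meas P v) E = ennreal ((norm (P E v))\<^sup>2)"
proof -
  have "emeasure (spec_meas P v) E = ennreal (Re (cinner v (P E v)))"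
    unfolding spec_meas_def
  proof (rule emeasure_measure_of_sigma)
    show "sigma_algebra UNIV (sets (borel :: real measure))"
      using sets.sigma_algebra_axioms[of "borel :: real measure"] by simp
    show "positive (sets borel) (\<lambda>E. ennreal (Re (cinner v (P E v))))"
      by (simp add: positive_def P_empty)
    show "countably_additive (sets borel) (\<lambda>E. ennreal (Re (cinner v (P E v))))"
    proof (rule countably_additiveI)
      fix A :: "nat \<Rightarrow> real set"
      assume A: "range A \<subseteq> sets borel" "disjoint_family A"
      have "(\<lambda>n. Re (cinner v (\<Sum>k<n. P (A k) v))) \<longlonglongrightarrow> Re (cinner v (P (\<Union>k. A k) v))"
        by (intro tendsto_Re tendsto_cinner_right P_sums A)
      then have "(\<lambda>k. Re (cinner v (P (A k) v))) sums Re (cinner v (P (\<Union>k. A k) v))"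
        by (simp add: sums_def cinner_sum_right)
      moreover have "0 \<le> Re (cinner v (P (A k) v))" for k
        using A by (subst cinner_P) auto
      ultimately show "(\<Sum>i. ennreal (Re (cinner v (P (A i) v))))
          = ennreal (Re (cinner v (P (\<Union> (range A)) v)))"
        by (intro suminf_ennreal_eq) auto
    qed
  qed fact
  then show ?thesis by (simp add: cinner_P[OF assms])
qed

lemma finite_measure_spec_meas: "finite_measure (spec_meas P v)"
  by (rule finite_measureI) (simp add: emeasure_spec_meas)

lemma measure_spec_meas:
  "E \<in> sets borel \<Longrightarrow> measure (spec_meas P v) E = (norm (P E v))\<^sup>2"
  by (simp add: measure_def emeasure_spec_meas)

lemma emeasure_spec_meas_UNIV: "emeasure (spec_meas P v) UNIV = ennreal ((norm v)\<^sup>2)"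
  by (simp add: emeasure_spec_meas P_UNIV)

lemma borel_measurable_spec_meas:
  "f \<in> borel_measurable borel \<Longrightarrow> f \<in> borel_measurable (spec_meas P v)"
  by measurable

lemma integrable_bounded_borel:
  assumes "bounded_borel f" shows "integrable (spec_meas P v) f"
proof -
  interpret finite_measure "spec_meas P v" by (rule finite_measure_spec_meas)
  from assms obtain K where "\<And>x. cmod (f x) \<le> K" "f \<in> borel_measurable borel"
    by (auto simp: bounded_borel_def)
  then show ?thesis
    by (intro integrable_const_bound[where B = K]) (auto intro: borel_measurable_spec_meas)
qed

lemma integral_indicator_spec_meas:
  assumes "E \<in> sets borel"
  shows "integral\<^sup>L (spec_meas P u) (indicator E :: real \<Rightarrow> complex) = cinner u (P E u)"
proof -
  have eq: "(indicator E :: real \<Rightarrow> complex) = (\<lambda>p. complex_of_real (indicator E p))"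
    by (auto simp: indicator_def)
  show ?thesis
    unfolding eq integral_complex_of_real using assms by (simp add: measure_spec_meas cinner_P)
qed

section \<open>Polarized integrals as a Hermitian form in the vectors\<close>

lemma polarized_integral_indicator:
  assumes E: "E \<in> sets borel"
  shows "polarized_integral P (indicator E) w v = cinner w (P E v)"
  unfolding polarized_integral_def
  by (simp add: integral_indicator_spec_meas[OF E] sum_lessThan_4 P_add[OF E] P_scaleC[OF E]
      cinner_add_right cinner_add_left cinner_scaleC_left cinner_scaleC_right power3_eq_cube
      field_simps)

lemma polarized_integral_add:
  assumes "bounded_borel f" "bounded_borel g"
  shows "polarized_integral P (\<lambda>x. f x + g x) w v
    = polarized_integral P f w v + polarized_integral P g w v"
  unfolding polarized_integral_def
  by (simp add: Bochner_Integration.integral_add integrable_bounded_borel assms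
      distrib_left sum.distrib)

lemma polarized_integral_scale:
  assumes "bounded_borel f"
  shows "polarized_integral P (\<lambda>x. c * f x) w v = c * polarized_integral P f w v"
  unfolding polarized_integral_def
  by (simp add: sum_distrib_left mult_ac)

lemma polarized_integral_diff:
  assumes "bounded_borel f" "bounded_borel g"
  shows "polarized_integral P (\<lambda>x. f x - g x) w v
    = polarized_integral P f w v - polarized_integral P g w v"
  unfolding polarized_integral_def
  by (simp add: Bochner_Integration.integral_diff integrable_bounded_borel assms
      right_diff_distrib sum_subtractf)

lemma integral_bounded_lim:
  fixes f :: "real \<Rightarrow> complex"
  assumes "\<And>n. s n \<in> borel_measurable borel" "f \<in> borel_measurable borel"
    and "\<And>n x. cmod (s n x) \<le> K" "\<And>x. (\<lambda>n. s n x) \<longlonglongrightarrow> f x"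
  shows "(\<lambda>n. integral\<^sup>L (spec_meas P v) (s n)) \<longlonglongrightarrow> integral\<^sup>L (spec_meas P v) f"
proof -
  interpret finite_measure "spec_meas P v" by (rule finite_measure_spec_meas)
  show ?thesis
    by (rule integral_dominated_convergence[where w = "\<lambda>_. K"])
      (use assms in \<open>auto intro: borel_measurable_spec_meas\<close>)
qed

lemma polarized_integral_lim:
  assumes "\<And>n. s n \<in> borel_measurable borel" "f \<in> borel_measurable borel"
    and "\<And>n x. cmod (s n x) \<le> K" "\<And>x. (\<lambda>n. s n x) \<longlonglongrightarrow> f x"
  shows "(\<lambda>n. polarized_integral P (s n) w v) \<longlonglongrightarrow> polarized_integral P f w v"
  unfolding polarized_integral_def
  by (intro tendsto_sum tendsto_mult tendsto_const integral_bounded_lim[OF assms])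

text \<open>\<open>spec_meas\<close> is quadratic in the vector, so additivity in v cannot be read
  off the four measures. On indicators the form is <w, P E v>, where it is clear, and induction over
  f carries it to all bounded functions.\<close>

lemma polarized_integral_add_right:
  assumes "bounded_borel f"
  shows "polarized_integral P f w (u + v) = polarized_integral P f w u + polarized_integral P f w v"
  using assms
proof (induction rule: bounded_borel_induct)
  case (lim s f K)
  have L: "(\<lambda>n. polarized_integral P (s n) w x) \<longlonglongrightarrow> polarized_integral P f w x" for x
    by (rule polarized_integral_lim[OF lim(1-3) lim(5)])
  show ?case
    using LIMSEQ_unique[OF L[of "u + v", unfolded lim(6)] tendsto_add[OF L[of u] L[of v]]] .
qed (simp_all add: polarized_integral_indicator P_add cinner_add_right polarized_integral_add
    polarized_integral_scale algebra_simps)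

lemma cnj_polarized_integral:
  assumes "bounded_borel f"
  shows "polarized_integral P (\<lambda>x. cnj (f x)) w v = cnj (polarized_integral P f v w)"
  using assms
proof (induction rule: bounded_borel_induct)
  case (indicator E)
  have "(\<lambda>x. cnj (indicator E x)) = (indicator E :: real \<Rightarrow> complex)"
    by (auto simp: indicator_def)
  then show ?case
    using indicator by (simp add: polarized_integral_indicator) (metis P_sym cinner_commute)
next
  case (lim s f K)
  have "(\<lambda>n. polarized_integral P (\<lambda>x. cnj (s n x)) w v)
      \<longlonglongrightarrow> polarized_integral P (\<lambda>x. cnj (f x)) w v"
    by (rule polarized_integral_lim[where K = K])
      (use lim in \<open>auto intro!: tendsto_cnj intro: borel_measurable_continuous_on[of cnj]
        continuous_intros\<close>)
  moreover have "(\<lambda>n. cnj (polarized_integral P (s n) v w)) \<longlonglongrightarrow> cnj (polarized_integral P f v w)"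
    by (intro tendsto_cnj polarized_integral_lim[OF lim(1-3) lim(5)])
  ultimately show ?case unfolding lim(6) by (rule LIMSEQ_unique)
qed (simp_all add: polarized_integral_add polarized_integral_scale bounded_borel_intros)

text \<open>Half of multiplicativity, with one factor an indicator: since P (E \<inter> F) = P E P F
  and P E is symmetric, restricting the complex measure of (w, v) to E amounts to projecting
  w.\<close>

lemma polarized_integral_indicator_mult:
  assumes "bounded_borel f" and E: "E \<in> sets borel"
  shows "polarized_integral P (\<lambda>x. indicator E x * f x) w v = polarized_integral P f (P E w) v"
  using assms(1)
proof (induction rule: bounded_borel_induct)
  case (indicator F)
  have "(\<lambda>x. indicator E x * indicator F x) = (indicator (E \<inter> F) :: real \<Rightarrow> complex)"
    by (auto simp: indicator_def)
  then show ?case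
    using indicator E by (simp add: polarized_integral_indicator P_Int P_sym)
next
  case (lim s f K)
  have "(\<lambda>n. polarized_integral P (\<lambda>x. indicator E x * s n x) w v)
      \<longlonglongrightarrow> polarized_integral P (\<lambda>x. indicator E x * f x) w v"
  proof (rule polarized_integral_lim[where K = K])
    show "cmod (indicator E x * s n x) \<le> K" for n x
      using lim(3)[of n x] by (auto simp: indicator_def intro: order_trans[OF norm_ge_zero])
    show "(\<lambda>x. indicator E x * s n x) \<in> borel_measurable borel" for n
      using lim(1)[of n] E by measurable
    show "(\<lambda>x. indicator E x * f x) \<in> borel_measurable borel"
      using lim(2) E by measurable
  qed (use lim in \<open>auto intro!: tendsto_intros\<close>)
  moreover have "(\<lambda>n. polarized_integral P (s n) (P E w) v) \<longlonglongrightarrow> polarized_integral P f (P E w) v"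
    by (intro polarized_integral_lim[OF lim(1-3) lim(5)])
  ultimately show ?case unfolding lim(6) by (rule LIMSEQ_unique)
next
  case (add f g)
  then show ?case
    using polarized_integral_add[of "\<lambda>x. indicator E x * f x" "\<lambda>x. indicator E x * g x" w v]
    by (simp add: polarized_integral_add bounded_borel_intros E distrib_left)
next
  case (scale c f)
  then show ?case
    using polarized_integral_scale[of "\<lambda>x. indicator E x * f x" c w v]
    by (simp add: polarized_integral_scale bounded_borel_intros E mult.left_commute)
qed

lemma polarized_integral_self:
  assumes "bounded_borel f"
  shows "polarized_integral P f v v = integral\<^sup>L (spec_meas P v) f"
  using assms
proof (induction rule: bounded_borel_induct)
  case (indicator E)
  then show ?case by (simp add: polarized_integral_indicator integral_indicator_spec_meas)
next
  case (lim s f K)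
  show ?case
    using LIMSEQ_unique[OF polarized_integral_lim[OF lim(1-3) lim(5), of v v, unfolded lim(6)]
       integral_bounded_lim[OF lim(1-3) lim(5)]] .
qed (simp_all add: polarized_integral_add polarized_integral_scale integrable_bounded_borel)

section \<open>Bounded functional calculus\<close>

definition represents :: "(real \<Rightarrow> complex) \<Rightarrow> 'a \<Rightarrow> 'a \<Rightarrow> bool" where
  "represents f v x \<longleftrightarrow> (\<forall>w. cinner w x = polarized_integral P f w v)"

text \<open>Multiplicativity is proved for any vector representing g, not for
  \<open>bcalc P g v\<close>, because \<open>represents_norm\<close> and through it the existence
  proof depend on it.\<close>

lemma polarized_integral_mult:
  assumes "bounded_borel f" and g: "bounded_borel g" and x: "represents g v x"
  shows "polarized_integral P f w x = polarized_integral P (\<lambda>p. f p * g p) w v"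
  using assms(1)
proof (induction rule: bounded_borel_induct)
  case (indicator E)
  then show ?case
    using x by (simp add: polarized_integral_indicator P_sym polarized_integral_indicator_mult g
        represents_def)
next
  case (lim s f K)
  from g obtain L where L: "\<And>p. cmod (g p) \<le> L" and [measurable]: "g \<in> borel_measurable borel"
    by (auto simp: bounded_borel_def)
  have [measurable]: "s n \<in> borel_measurable borel" "f \<in> borel_measurable borel" for n
    using lim by auto
  have "(\<lambda>n. polarized_integral P (\<lambda>p. s n p * g p) w v)
      \<longlonglongrightarrow> polarized_integral P (\<lambda>p. f p * g p) w v"
  proof (rule polarized_integral_lim[where K = "K * L"])
    show "cmod (s n p * g p) \<le> K * L" for n p
      unfolding norm_mult using lim(3)[of n p] L[of p]
      by (meson mult_mono norm_ge_zero order_trans)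
  qed (use lim(5) in \<open>auto intro!: tendsto_intros\<close>)
  moreover have "(\<lambda>n. polarized_integral P (\<lambda>p. s n p * g p) w v) \<longlonglongrightarrow> polarized_integral P f w x"
    unfolding lim(6) [symmetric] by (rule polarized_integral_lim[OF lim(1-3) lim(5)])
  ultimately show ?case by (rule LIMSEQ_unique [rotated])
next
  case (add f h)
  then show ?case
    using polarized_integral_add[of "\<lambda>p. f p * g p" "\<lambda>p. h p * g p" w v]
    by (simp add: polarized_integral_add bounded_borel_intros g distrib_right)
next
  case (scale c f)
  then show ?case
    using polarized_integral_scale[of "\<lambda>p. f p * g p" c w v]
    by (simp add: polarized_integral_scale bounded_borel_intros g mult.assoc)
qed

text \<open><x, x> is the form of g at (x, v); Hermitian symmetry and multiplicativity turn it into
  the diagonal integral of cnj g * g. The real version serves L^2 estimates, the one in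
  \<open>ennreal\<close> matches \<open>fdom\<close>.\<close>

lemma represents_norm:
  assumes g: "bounded_borel g" and x: "represents g v x"
  shows "ennreal ((norm x)\<^sup>2) = (\<integral>\<^sup>+p. ennreal ((cmod (g p))\<^sup>2) \<partial>spec_meas P v)"
    and "(norm x)\<^sup>2 = (\<integral>p. (cmod (g p))\<^sup>2 \<partial>spec_meas P v)"
proof -
  have gg: "bounded_borel (\<lambda>p. cnj (g p) * g p)" by (intro bounded_borel_intros g)
  have eq: "(\<lambda>p. cnj (g p) * g p) = (\<lambda>p. complex_of_real ((cmod (g p))\<^sup>2))"
    by (simp only: complex_norm_square mult.commute)
  have "cinner x x = polarized_integral P g x v"
    using x by (simp add: represents_def)
  also have "\<dots> = cnj (polarized_integral P (\<lambda>p. cnj (g p)) v x)"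
    using cnj_polarized_integral[OF bounded_borel_cnj[OF g], of x v] by simp
  also have "\<dots> = cnj (polarized_integral P (\<lambda>p. cnj (g p) * g p) v v)"
    using polarized_integral_mult[OF bounded_borel_cnj[OF g] g x] by simp
  also have "\<dots> = cnj (\<integral>p. cnj (g p) * g p \<partial>spec_meas P v)"
    using polarized_integral_self[OF gg] by simp
  also have "\<dots> = complex_of_real (\<integral>p. (cmod (g p))\<^sup>2 \<partial>spec_meas P v)"
    unfolding eq integral_complex_of_real by simp
  finally show *: "(norm x)\<^sup>2 = (\<integral>p. (cmod (g p))\<^sup>2 \<partial>spec_meas P v)"
    by (simp only: cinner_self of_real_eq_iff)
  have "integrable (spec_meas P v) (\<lambda>p. (cmod (g p))\<^sup>2)"
    using integrable_bounded_borel[OF gg, of v] unfolding eq complex_of_real_integrable_eq .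
  then show "ennreal ((norm x)\<^sup>2) = (\<integral>\<^sup>+p. ennreal ((cmod (g p))\<^sup>2) \<partial>spec_meas P v)"
    unfolding * by (subst nn_integral_eq_integral) auto
qed

lemma represents_diff:
  assumes "bounded_borel f" "bounded_borel g" "represents f v x" "represents g v y"
  shows "represents (\<lambda>p. f p - g p) v (x - y)"
  using assms by (simp add: represents_def polarized_integral_diff cinner_diff_right)

text \<open>The isometry compares s n with s m, and both are compared with f through |a - b|^2 <= 2
  |a - f|^2 + 2 |b - f|^2; the threshold e^2 / 4 makes the two terms add up to e^2. As f enters only
  as an L^2 limit, this serves bounded limits and truncations of unbounded functions alike.\<close>

lemma represents_Cauchy:
  assumes bs: "\<And>n::nat. bounded_borel (s n)" and x: "\<And>n. represents (s n) v (x n)"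
    and int: "\<And>n. integrable (spec_meas P v) (\<lambda>p. (cmod (s n p - f p))\<^sup>2)"
    and a0: "(\<lambda>n. \<integral>p. (cmod (s n p - f p))\<^sup>2 \<partial>spec_meas P v) \<longlonglongrightarrow> 0"
  shows "Cauchy x"
proof -
  define a where "a n = (\<integral>p. (cmod (s n p - f p))\<^sup>2 \<partial>spec_meas P v)" for n
  have a0: "a \<longlonglongrightarrow> 0" using a0 by (simp add: a_def [abs_def])
  have est: "(norm (x n - x m))\<^sup>2 \<le> 2 * a n + 2 * a m" for n m
  proof -
    have "(norm (x n - x m))\<^sup>2 = (\<integral>p. (cmod (s n p - s m p))\<^sup>2 \<partial>spec_meas P v)"
      by (rule represents_norm(2)[OF bounded_borel_diff[OF bs bs] represents_diff[OF bs bs x x]])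
    also have "\<dots> \<le> (\<integral>p. 2 * (cmod (s n p - f p))\<^sup>2 + 2 * (cmod (s m p - f p))\<^sup>2 \<partial>spec_meas P v)"
    proof (rule integral_mono_AE')
      show "AE p in spec_meas P v. (cmod (s n p - s m p))\<^sup>2
          \<le> 2 * (cmod (s n p - f p))\<^sup>2 + 2 * (cmod (s m p - f p))\<^sup>2"
      proof (rule AE_I2)
        fix p
        have "(cmod (s n p - s m p))\<^sup>2 \<le> (cmod (s n p - f p) + cmod (s m p - f p))\<^sup>2"
          using norm_triangle_ineq4[of "s n p - f p" "s m p - f p"] by (intro power_mono) auto
        also have "\<dots> \<le> 2 * (cmod (s n p - f p))\<^sup>2 + 2 * (cmod (s m p - f p))\<^sup>2"
          using sum_squares_bound[of "cmod (s n p - f p)" "cmod (s m p - f p)"]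
          by (simp add: power2_sum)
        finally show "(cmod (s n p - s m p))\<^sup>2
          \<le> 2 * (cmod (s n p - f p))\<^sup>2 + 2 * (cmod (s m p - f p))\<^sup>2" .
      qed
    qed (use int in auto)
    also have "\<dots> = 2 * a n + 2 * a m"
      unfolding a_def using int by simp
    finally show ?thesis .
  qed
  show ?thesis
  proof (rule metric_CauchyI)
    fix e :: real assume e: "e > 0"
    have "\<forall>\<^sub>F n in sequentially. a n < e\<^sup>2 / 4"
      using order_tendstoD(2)[OF a0, of "e\<^sup>2 / 4"] e by simp
    then obtain N where N: "\<And>n. n \<ge> N \<Longrightarrow> a n < e\<^sup>2 / 4"
      by (auto simp: eventually_sequentially)
    have "dist (x m) (x n) < e" if "m \<ge> N" "n \<ge> N" for m n
    proof -
      have "(norm (x m - x n))\<^sup>2 < e\<^sup>2" using est[of m n] N[OF that(1)] N[OF that(2)] by simp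
      then show ?thesis using e by (simp add: dist_norm power_less_imp_less_base)
    qed
    then show "\<exists>M. \<forall>m\<ge>M. \<forall>n\<ge>M. dist (x m) (x n) < e" by blast
  qed
qed

text \<open>For a bounded pointwise limit, dominated convergence on the finite measure gives L^2
  convergence, hence a Cauchy sequence of representing vectors; its limit is identified by testing
  against each w.\<close>

lemma represents_exists:
  assumes "bounded_borel f"
  shows "\<exists>x. represents f v x"
  using assms
proof (induction rule: bounded_borel_induct)
  case (indicator E)
  then show ?case by (auto simp: represents_def polarized_integral_indicator)
next
  case (add f g)
  then obtain x y where "represents f v x" "represents g v y" by auto
  then have "represents (\<lambda>p. f p + g p) v (x + y)"
    using add by (simp add: represents_def polarized_integral_add cinner_add_right)
  then show ?case ..
next
  case (scale c f)
  then obtain x where "represents f v x" by auto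
  then have "represents (\<lambda>p. c * f p) v (scaleC c x)"
    using scale by (simp add: represents_def polarized_integral_scale cinner_scaleC_right)
  then show ?case ..
next
  case (lim s f K)
  from lim(6) obtain x where x: "\<And>n. represents (s n) v (x n)" by metis
  have [measurable]: "s n \<in> borel_measurable borel" "f \<in> borel_measurable borel" for n
    using lim by auto
  have bs: "bounded_borel (s n)" for n using lim by (intro bounded_borelI) auto
  interpret finite_measure "spec_meas P v" by (rule finite_measure_spec_meas)
  have bnd: "cmod (s n p - f p) \<le> 2 * K" for n p
    using norm_triangle_ineq4[of "s n p" "f p"] lim(3)[of n p] lim(4)[of p] by linarith
  have "(\<lambda>n. \<integral>p. (cmod (s n p - f p))\<^sup>2 \<partial>spec_meas P v) \<longlonglongrightarrow> (\<integral>p. 0 \<partial>spec_meas P v)"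
  proof (rule integral_dominated_convergence[where w = "\<lambda>_. (2 * K)\<^sup>2"])
    show "AE p in spec_meas P v. (\<lambda>n. (cmod (s n p - f p))\<^sup>2) \<longlonglongrightarrow> 0"
    proof (rule AE_I2)
      fix p
      have "(\<lambda>n. (cmod (s n p - f p))\<^sup>2) \<longlonglongrightarrow> (cmod (f p - f p))\<^sup>2"
        by (intro tendsto_intros lim)
      then show "(\<lambda>n. (cmod (s n p - f p))\<^sup>2) \<longlonglongrightarrow> 0" by simp
    qed
    show "AE p in spec_meas P v. norm ((cmod (s n p - f p))\<^sup>2) \<le> (2 * K)\<^sup>2" for n
      using power_mono[OF bnd norm_ge_zero, of n _ 2] by (intro AE_I2) simp
  qed auto
  then have a0: "(\<lambda>n. \<integral>p. (cmod (s n p - f p))\<^sup>2 \<partial>spec_meas P v) \<longlonglongrightarrow> 0" by simp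
  have int: "integrable (spec_meas P v) (\<lambda>p. (cmod (s n p - f p))\<^sup>2)" for n
    using power_mono[OF bnd norm_ge_zero, of n _ 2]
    by (intro integrable_const_bound[where B = "(2 * K)\<^sup>2"] AE_I2) (simp, measurable)
  have "Cauchy x"
    by (rule represents_Cauchy[OF bs x int a0])
  then obtain y where y: "x \<longlonglongrightarrow> y" by (auto simp: Cauchy_convergent_iff convergent_def)
  have "cinner w y = polarized_integral P f w v" for w
    using LIMSEQ_unique[OF tendsto_cinner_right[OF y, of w]]
      polarized_integral_lim[OF lim(1-3) lim(5), of w v]
    using x by (simp add: represents_def)
  then show ?case by (auto simp: represents_def)
qed

lemma represents_bcalc:
  assumes "bounded_borel f" shows "represents f v (bcalc P f v)"
proof -
  have eq: "bcalc P f v = (THE x. represents f v x)"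
    by (simp add: bcalc_def represents_def polarized_integral_def)
  obtain x where x: "represents f v x" using represents_exists[OF assms] ..
  show ?thesis unfolding eq
  proof (rule theI[of "represents f v", OF x])
    fix y assume "represents f v y"
    then show "y = x" using x by (intro cinner_ext) (simp add: represents_def)
  qed
qed

lemma cinner_bcalc: "bounded_borel f \<Longrightarrow> cinner w (bcalc P f v) = polarized_integral P f w v"
  using represents_bcalc by (simp add: represents_def)

lemma bcalc_eqI: "bounded_borel f \<Longrightarrow> represents f v x \<Longrightarrow> bcalc P f v = x"
  using represents_bcalc[of f v] by (intro cinner_ext) (simp add: represents_def)

lemma bcalc_indicator: "E \<in> sets borel \<Longrightarrow> bcalc P (indicator E) v = P E v"
  by (intro bcalc_eqI bounded_borel_intros)
    (simp_all add: represents_def polarized_integral_indicator)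

lemma bcalc_one: "bcalc P (\<lambda>_. 1) v = v"
proof -
  have "indicator UNIV = (\<lambda>_::real. 1::complex)" by auto
  then show ?thesis using bcalc_indicator[of UNIV v] by (simp add: P_UNIV)
qed

lemma bcalc_mult:
  assumes "bounded_borel f" "bounded_borel g"
  shows "bcalc P f (bcalc P g v) = bcalc P (\<lambda>p. f p * g p) v"
  by (rule cinner_ext) (simp add: cinner_bcalc assms bounded_borel_intros
      polarized_integral_mult[OF assms represents_bcalc[OF assms(2)]])

lemma bcalc_diff_fun:
  assumes "bounded_borel f" "bounded_borel g"
  shows "bcalc P (\<lambda>p. f p - g p) v = bcalc P f v - bcalc P g v"
  by (intro bcalc_eqI bounded_borel_diff represents_diff represents_bcalc assms)

lemma bcalc_add:
  assumes "bounded_borel f"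
  shows "bcalc P f (u + v) = bcalc P f u + bcalc P f v"
  using assms by (intro bcalc_eqI)
    (simp_all add: represents_def cinner_add_right cinner_bcalc polarized_integral_add_right)

lemma bcalc_diff:
  assumes "bounded_borel f"
  shows "bcalc P f (u - v) = bcalc P f u - bcalc P f v"
  using bcalc_add[OF assms, of "u - v" v] by simp

lemma bcalc_adjoint:
  assumes "bounded_borel f"
  shows "cinner (bcalc P f w) v = cinner w (bcalc P (\<lambda>p. cnj (f p)) v)"
proof -
  have "cinner (bcalc P f w) v = cnj (polarized_integral P f v w)"
    using assms by (metis cinner_bcalc cinner_commute)
  then show ?thesis
    by (simp add: cinner_bcalc bounded_borel_intros assms cnj_polarized_integral)
qed

lemma norm_bcalc:
  assumes "bounded_borel f"
  shows "ennreal ((norm (bcalc P f v))\<^sup>2) = (\<integral>\<^sup>+p. ennreal ((cmod (f p))\<^sup>2) \<partial>spec_meas P v)"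
  by (rule represents_norm(1)[OF assms represents_bcalc[OF assms]])

lemma bcalc_LIMSEQ:
  assumes f: "bounded_borel f" and x: "x \<longlonglongrightarrow> y"
  shows "(\<lambda>n. bcalc P f (x n)) \<longlonglongrightarrow> bcalc P f y"
proof -
  obtain K where K: "\<And>p. cmod (f p) \<le> K" using f by (auto simp: bounded_borel_def)
  have K0: "0 \<le> K" using K norm_ge_zero order_trans by blast
  have bnd: "norm (bcalc P f u) \<le> K * norm u" for u
  proof -
    have "ennreal ((norm (bcalc P f u))\<^sup>2) \<le> (\<integral>\<^sup>+p. ennreal (K\<^sup>2) \<partial>spec_meas P u)"
      unfolding norm_bcalc[OF f]
      by (intro nn_integral_mono ennreal_leI power_mono K) auto
    also have "\<dots> = ennreal ((K * norm u)\<^sup>2)"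
      by (simp add: emeasure_spec_meas_UNIV ennreal_mult power_mult_distrib)
    finally have "(norm (bcalc P f u))\<^sup>2 \<le> (K * norm u)\<^sup>2" by simp
    then show ?thesis by (rule power2_le_imp_le) (simp add: K0)
  qed
  show ?thesis
  proof (rule Lim_null_comparison[THEN LIM_zero_cancel])
    show "(\<lambda>n. K * norm (x n - y)) \<longlonglongrightarrow> 0"
      using x by (intro tendsto_mult_right_zero tendsto_norm_zero LIM_zero)
  qed (simp add: bcalc_diff[OF f, symmetric] bnd)
qed

section \<open>Unbounded functions and their domains\<close>

lemma bounded_borel_trunc:
  assumes "f \<in> borel_measurable borel"
  shows "bounded_borel (\<lambda>p. f p * indicator {p. cmod (f p) \<le> real n} p)"
proof (rule bounded_borelI[where K = "real n"])
  have "{p \<in> space borel. cmod (f p) \<le> real n} \<in> sets borel"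
    using assms by measurable
  then show "(\<lambda>p. f p * indicator {p. cmod (f p) \<le> real n} p) \<in> borel_measurable borel"
    using assms by simp
qed (auto simp: indicator_def)

lemma trunc_eventually:
  fixes f :: "real \<Rightarrow> complex"
  shows "\<forall>\<^sub>F n in sequentially. f p * indicator {p. cmod (f p) \<le> real n} p = f p"
proof -
  obtain N where "cmod (f p) \<le> real N" using real_arch_simple by blast
  then have "f p * indicator {p. cmod (f p) \<le> real n} p = f p" if "n \<ge> N" for n
    using that by (auto simp: indicator_def)
  then show ?thesis by (auto simp: eventually_sequentially)
qed

text \<open>On the domain |f|^2 is integrable and dominates |s n - f|^2, because a truncation equals
  f or 0. The truncations therefore converge in L^2, and \<open>lim\<close> in \<open>fcalc\<close>
  denotes a genuine limit.\<close>

lemma fcalc_LIMSEQ: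
  assumes f: "f \<in> borel_measurable borel" and v: "v \<in> fdom P f"
  shows "(\<lambda>n. bcalc P (\<lambda>p. f p * indicator {p. cmod (f p) \<le> real n} p) v) \<longlonglongrightarrow> fcalc P f v"
proof -
  define s where "s n p = f p * indicator {p. cmod (f p) \<le> real n} p" for n p
  have bs: "bounded_borel (s n)" for n
    unfolding s_def [abs_def] by (rule bounded_borel_trunc[OF f])
  have [measurable]: "s n \<in> borel_measurable borel" "f \<in> borel_measurable borel" for n
    using bs f by (auto simp: bounded_borel_def)
  have int: "integrable (spec_meas P v) (\<lambda>p. (cmod (f p))\<^sup>2)"
    using v by (intro integrableI_nonneg) (auto simp: fdom_def top.not_eq_extremum)
  have le: "cmod (s n p - f p) \<le> cmod (f p)" for n p
    by (auto simp: s_def indicator_def)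
  have "(\<lambda>n. \<integral>p. (cmod (s n p - f p))\<^sup>2 \<partial>spec_meas P v) \<longlonglongrightarrow> (\<integral>p. 0 \<partial>spec_meas P v)"
  proof (rule integral_dominated_convergence[where w = "\<lambda>p. (cmod (f p))\<^sup>2"])
    show "AE p in spec_meas P v. (\<lambda>n. (cmod (s n p - f p))\<^sup>2) \<longlonglongrightarrow> 0"
    proof (rule AE_I2)
      fix p
      have "\<forall>\<^sub>F n in sequentially. (cmod (s n p - f p))\<^sup>2 = 0"
        using trunc_eventually[of f p] by eventually_elim (simp add: s_def)
      then show "(\<lambda>n. (cmod (s n p - f p))\<^sup>2) \<longlonglongrightarrow> 0" by (rule tendsto_eventually)
    qed
    show "AE p in spec_meas P v. norm ((cmod (s n p - f p))\<^sup>2) \<le> (cmod (f p))\<^sup>2" for n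
      using power_mono[OF le norm_ge_zero, of n _ 2] by (intro AE_I2) simp
  qed (use int in auto)
  then have a0: "(\<lambda>n. \<integral>p. (cmod (s n p - f p))\<^sup>2 \<partial>spec_meas P v) \<longlonglongrightarrow> 0" by simp
  have int': "integrable (spec_meas P v) (\<lambda>p. (cmod (s n p - f p))\<^sup>2)" for n
    using power_mono[OF le norm_ge_zero, of n _ 2]
    by (intro Bochner_Integration.integrable_bound[OF int]) (auto intro!: AE_I2)
  have "Cauchy (\<lambda>n. bcalc P (s n) v)"
    by (rule represents_Cauchy[OF bs represents_bcalc[OF bs] int' a0])
  then have "convergent (\<lambda>n. bcalc P (s n) v)" by (simp add: Cauchy_convergent_iff)
  then show ?thesis
    unfolding fcalc_def by (simp add: convergent_LIMSEQ_iff s_def [abs_def])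
qed

lemma fdom_bounded:
  assumes "bounded_borel f" shows "v \<in> fdom P f"
  by (simp add: fdom_def norm_bcalc[OF assms, symmetric])

text \<open>The way back from unbounded to bounded functions: continuity of h(P) passes it through
  the limit in \<open>fcalc\<close>, and the bound on h f dominates all products of h with
  truncations of f.\<close>

lemma bcalc_fcalc:
  assumes f: "f \<in> borel_measurable borel" and v: "v \<in> fdom P f"
    and h: "bounded_borel h" and hf: "bounded_borel (\<lambda>p. h p * f p)"
  shows "bcalc P h (fcalc P f v) = bcalc P (\<lambda>p. h p * f p) v"
proof (rule cinner_ext)
  fix w
  define s where "s n p = f p * indicator {p. cmod (f p) \<le> real n} p" for n p
  have bs: "bounded_borel (s n)" for n
    unfolding s_def [abs_def] by (rule bounded_borel_trunc[OF f])
  have [measurable]: "s n \<in> borel_measurable borel" "f \<in> borel_measurable borel"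
    "h \<in> borel_measurable borel" for n
    using bs f h by (auto simp: bounded_borel_def)
  obtain K where K: "\<And>p. cmod (h p * f p) \<le> K" using hf by (auto simp: bounded_borel_def)
  have "(\<lambda>n. polarized_integral P (\<lambda>p. h p * s n p) w v)
      \<longlonglongrightarrow> polarized_integral P (\<lambda>p. h p * f p) w v"
  proof (rule polarized_integral_lim[where K = K])
    show "cmod (h p * s n p) \<le> K" for n p
    proof -
      have "cmod (h p * s n p) \<le> cmod (h p * f p)" by (auto simp: s_def indicator_def)
      then show ?thesis using K[of p] by linarith
    qed
    show "(\<lambda>n. h p * s n p) \<longlonglongrightarrow> h p * f p" for p
      using trunc_eventually[of f p] unfolding s_def
      by (intro tendsto_mult tendsto_const tendsto_eventually)
  qed auto
  moreover have "(\<lambda>n. polarized_integral P (\<lambda>p. h p * s n p) w v)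
      \<longlonglongrightarrow> cinner w (bcalc P h (fcalc P f v))"
  proof -
    have "(\<lambda>n. cinner w (bcalc P h (bcalc P (s n) v))) \<longlonglongrightarrow> cinner w (bcalc P h (fcalc P f v))"
      using fcalc_LIMSEQ[OF f v] unfolding s_def [abs_def]
      by (intro tendsto_cinner_right bcalc_LIMSEQ h)
    then show ?thesis
      by (simp add: bcalc_mult h bs cinner_bcalc bounded_borel_mult)
  qed
  ultimately show "cinner w (bcalc P h (fcalc P f v)) = cinner w (bcalc P (\<lambda>p. h p * f p) v)"
    unfolding cinner_bcalc[OF hf] by (rule LIMSEQ_unique[rotated])
qed

lemma fcalc_bounded:
  assumes "bounded_borel f"
  shows "fcalc P f v = bcalc P f v"
  using bcalc_fcalc[OF bounded_borel_measurable[OF assms] fdom_bounded[OF assms]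
      bounded_borel_const[of 1]] assms
  by (simp add: bcalc_one)

text \<open>A vector whose spectral cut-offs are those of \<open>\<phi>(P) v\<close> has spectral measure
  \<open>\<bar>\<phi>\<bar>\<^sup>2 dP\<^sup>v\<close>, even though \<open>v\<close> is not known to lie in the domain of \<open>\<phi>(P)\<close>.\<close>
lemma spec_meas_eq_density:
  assumes E: "\<And>n::nat. E n \<in> sets borel" and inc: "incseq E" and un: "(\<Union>n. E n) = UNIV"
    and [measurable]: "\<phi> \<in> borel_measurable borel"
    and bnd: "\<And>n. bounded_borel (\<lambda>p. indicator (E n) p * \<phi> p)"
    and cut: "\<And>n. P (E n) z = bcalc P (\<lambda>p. indicator (E n) p * \<phi> p) v"
  shows "spec_meas P z = density (spec_meas P v) (\<lambda>p. ennreal ((cmod (\<phi> p))\<^sup>2))"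
    (is "?M = ?D")
proof (rule measure_eqI)
  show "sets ?M = sets ?D" by simp
  fix F assume "F \<in> sets ?M"
  then have F [measurable]: "F \<in> sets borel" by simp
  have [measurable]: "E n \<in> sets borel" for n by (rule E)
  have cut_eq: "emeasure ?M (F \<inter> E n) = emeasure ?D (F \<inter> E n)" for n
  proof -
    have "P (F \<inter> E n) z = bcalc P (indicator F) (bcalc P (\<lambda>p. indicator (E n) p * \<phi> p) v)"
      by (simp add: P_Int F E cut bcalc_indicator)
    also have "\<dots> = bcalc P (\<lambda>p. indicator F p * (indicator (E n) p * \<phi> p)) v"
      by (intro bcalc_mult bounded_borel_intros F bnd)
    finally have "emeasure ?M (F \<inter> E n)
        = (\<integral>\<^sup>+p. ennreal ((cmod (indicator F p * (indicator (E n) p * \<phi> p)))\<^sup>2) \<partial>spec_meas P v)"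
      by (simp add: emeasure_spec_meas
          norm_bcalc[OF bounded_borel_mult[OF bounded_borel_indicator[OF F] bnd]])
    also have "\<dots> = (\<integral>\<^sup>+p. ennreal ((cmod (\<phi> p))\<^sup>2) * indicator (F \<inter> E n) p \<partial>spec_meas P v)"
      by (intro nn_integral_cong) (auto simp: indicator_def)
    also have "\<dots> = emeasure ?D (F \<inter> E n)"
      by (subst emeasure_density) auto
    finally show ?thesis .
  qed
  have inc': "incseq (\<lambda>n. F \<inter> E n)" using inc by (auto simp: incseq_def)
  \<comment> \<open>Continuity from below along the exhaustion \<open>E n\<close> holds even where
    the density has infinite mass.\<close>
  have "emeasure ?M F = (SUP n. emeasure ?M (F \<inter> E n))"
    using SUP_emeasure_incseq[of "\<lambda>n. F \<inter> E n" ?M] inc' by (simp add: un image_subset_iff)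
  also have "\<dots> = (SUP n. emeasure ?D (F \<inter> E n))" by (simp add: cut_eq)
  also have "\<dots> = emeasure ?D F"
    using SUP_emeasure_incseq[of "\<lambda>n. F \<inter> E n" ?D] inc' by (simp add: un image_subset_iff)
  finally show "emeasure ?M F = emeasure ?D F" .
qed

text \<open>With h = (1 + p^2)^(-N), f = e^(tp) and g the endpoint function, the total mass of this
  measure is the squared distance of h(A) e^(tA) v from its limit; with h = 1 and g = 0 it describes
  f(A) v. The sets \<open>E n\<close> keep the points where |f| and |g| are at most n, so both
  summands become bounded.\<close>

lemma spec_meas_bcalc_fcalc_diff:
  assumes f [measurable]: "f \<in> borel_measurable borel" and v: "v \<in> fdom P f"
    and g [measurable]: "g \<in> borel_measurable borel" and vg: "v \<in> fdom P g"
    and h: "bounded_borel h"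
  shows "spec_meas P (bcalc P h (fcalc P f v) - fcalc P g v)
    = density (spec_meas P v) (\<lambda>p. ennreal ((cmod (h p * f p - g p))\<^sup>2))"
proof -
  have [measurable]: "h \<in> borel_measurable borel" using h by (simp add: bounded_borel_def)
  define E where "E n = {p \<in> space borel. cmod (f p) \<le> real n \<and> cmod (g p) \<le> real n}" for n
  have E [measurable]: "E n \<in> sets borel" for n unfolding E_def by measurable
  have bf: "bounded_borel (\<lambda>p. indicator (E n) p * f p)" for n
    by (rule bounded_borelI[where K = "real n"]) (auto simp: E_def indicator_def)
  have bg: "bounded_borel (\<lambda>p. indicator (E n) p * g p)" for n
    by (rule bounded_borelI[where K = "real n"]) (auto simp: E_def indicator_def)
  have eq: "(\<lambda>p. indicator (E n) p * (h p * f p - g p))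
    = (\<lambda>p. h p * (indicator (E n) p * f p) - indicator (E n) p * g p)" for n
    by (auto simp: algebra_simps)
  have bh: "bounded_borel (\<lambda>p. h p * indicator (E n) p)" for n
    by (intro bounded_borel_intros h E)
  show ?thesis
  proof (rule spec_meas_eq_density[where E = E])
    show "incseq E" by (auto simp: incseq_def E_def)
    show "(\<Union>n. E n) = UNIV"
    proof safe
      fix p show "p \<in> (\<Union>n. E n)"
        using real_arch_simple[of "max (cmod (f p)) (cmod (g p))"] by (auto simp: E_def)
    qed auto
    show "bounded_borel (\<lambda>p. indicator (E n) p * (h p * f p - g p))" for n
      unfolding eq by (intro bounded_borel_intros h bf bg)
    have "P (E n) (bcalc P h (fcalc P f v)) = bcalc P (\<lambda>p. h p * (indicator (E n) p * f p)) v" for n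
    proof -
      have "P (E n) (bcalc P h (fcalc P f v))
          = bcalc P (\<lambda>p. h p * indicator (E n) p) (fcalc P f v)"
        by (simp add: bcalc_indicator[OF E, symmetric] bcalc_mult bounded_borel_indicator E h
            mult.commute)
      also have "\<dots> = bcalc P (\<lambda>p. h p * indicator (E n) p * f p) v"
        using bounded_borel_mult[OF h bf] by (intro bcalc_fcalc f v bh) (simp add: mult.assoc)
      finally show ?thesis by (simp add: mult.assoc)
    qed
    moreover have "P (E n) (fcalc P g v) = bcalc P (\<lambda>p. indicator (E n) p * g p) v" for n
      unfolding bcalc_indicator[OF E, symmetric]
      by (rule bcalc_fcalc[OF g vg bounded_borel_indicator[OF E] bg])
    ultimately show "P (E n) (bcalc P h (fcalc P f v) - fcalc P g v)
        = bcalc P (\<lambda>p. indicator (E n) p * (h p * f p - g p)) v" for n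
      unfolding eq P_diff[OF E]
      by (simp add: bcalc_diff_fun bounded_borel_mult h bf bg)
  qed (use E in auto)
qed

lemma spec_meas_fcalc:
  assumes f: "f \<in> borel_measurable borel" and v: "v \<in> fdom P f"
  shows "spec_meas P (fcalc P f v) = density (spec_meas P v) (\<lambda>p. ennreal ((cmod (f p))\<^sup>2))"
proof -
  have "bcalc P (\<lambda>_. 0) v = 0"
    using bcalc_diff_fun[OF bounded_borel_const[of 0] bounded_borel_const[of 0], of v] by simp
  then show ?thesis
    using spec_meas_bcalc_fcalc_diff[OF f v _ fdom_bounded[OF bounded_borel_const[of 0]]
        bounded_borel_const[of 1]]
    by (simp add: bcalc_one fcalc_bounded bounded_borel_const)
qed

lemma nn_integral_spec_meas_fcalc:
  assumes [measurable]: "f \<in> borel_measurable borel" and v: "v \<in> fdom P f"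
    and [measurable]: "g \<in> borel_measurable borel"
  shows "(\<integral>\<^sup>+p. g p \<partial>spec_meas P (fcalc P f v))
    = (\<integral>\<^sup>+p. ennreal ((cmod (f p))\<^sup>2) * g p \<partial>spec_meas P v)"
  unfolding spec_meas_fcalc[OF assms(1,2)] by (subst nn_integral_density) auto

lemma norm_fcalc:
  assumes "f \<in> borel_measurable borel" "v \<in> fdom P f"
  shows "ennreal ((norm (fcalc P f v))\<^sup>2) = (\<integral>\<^sup>+p. ennreal ((cmod (f p))\<^sup>2) \<partial>spec_meas P v)"
  using nn_integral_spec_meas_fcalc[OF assms, of "\<lambda>_. 1"]
  by (simp add: emeasure_spec_meas_UNIV)

section \<open>Powers of A and smooth vectors\<close>

lemma domA_iff: "v \<in> domA P \<longleftrightarrow> (\<integral>\<^sup>+p. ennreal (p\<^sup>2) \<partial>spec_meas P v) < \<infinity>"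
  by (simp add: domA_def fdom_def)

text \<open>The spectral measure of A v is p^2 dP^v, so even moments shift by one index. This is the
  induction step for norms and domains of powers of A.\<close>

lemma nn_integral_spec_meas_opA:
  assumes "v \<in> domA P"
  shows "(\<integral>\<^sup>+p. ennreal (p ^ (2 * n)) \<partial>spec_meas P (opA P v))
    = (\<integral>\<^sup>+p. ennreal (p ^ (2 * Suc n)) \<partial>spec_meas P v)"
proof -
  have [measurable]: "complex_of_real \<in> borel_measurable borel"
    by (intro borel_measurable_continuous_onI continuous_intros)
  have "ennreal (p\<^sup>2) * ennreal (p ^ (2 * n)) = ennreal (p ^ (2 * Suc n))" for p :: real
    by (subst ennreal_mult [symmetric]) (auto simp: power2_eq_square zero_le_power_eq mult.assoc)
  moreover have "(\<lambda>p::real. ennreal (p ^ (2 * n))) \<in> borel_measurable borel"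
    by measurable
  ultimately show ?thesis
    using nn_integral_spec_meas_fcalc[of complex_of_real v "\<lambda>p. ennreal (p ^ (2 * n))"] assms
    by (simp add: opA_def domA_def)
qed

lemma norm_opA_power:
  "v \<in> domApow P n \<Longrightarrow>
    ennreal ((norm ((opA P ^^ n) v))\<^sup>2) = (\<integral>\<^sup>+p. ennreal (p ^ (2 * n)) \<partial>spec_meas P v)"
proof (induction n arbitrary: v)
  case 0
  then show ?case by (simp add: emeasure_spec_meas_UNIV)
next
  case (Suc n)
  then show ?case
    using Suc.IH[of "opA P v"] nn_integral_spec_meas_opA[of v n]
    by (simp add: funpow_swap1 del: mult_Suc_right)
qed

lemma domApowI:
  "(\<And>k. k \<le> n \<Longrightarrow> (\<integral>\<^sup>+p. ennreal (p ^ (2 * k)) \<partial>spec_meas P v) < \<infinity>) \<Longrightarrow> v \<in> domApow P n"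
proof (induction n arbitrary: v)
  case (Suc n)
  have v: "v \<in> domA P" using Suc.prems[of 1] by (simp add: domA_iff power2_eq_square)
  moreover have "opA P v \<in> domApow P n"
    using Suc.prems by (intro Suc.IH) (simp add: nn_integral_spec_meas_opA[OF v] del: mult_Suc_right)
  ultimately show ?case by simp
qed simp

lemma norm_opA_power_smooth:
  "v \<in> smooth_vecs P \<Longrightarrow>
    ennreal ((norm ((opA P ^^ n) v))\<^sup>2) = (\<integral>\<^sup>+p. ennreal (p ^ (2 * n)) \<partial>spec_meas P v)"
  by (rule norm_opA_power) (simp add: smooth_vecs_def)

lemma smooth_vecs_iff:
  "v \<in> smooth_vecs P \<longleftrightarrow> (\<forall>k. (\<integral>\<^sup>+p. ennreal (p ^ (2 * k)) \<partial>spec_meas P v) < \<infinity>)"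
  using norm_opA_power_smooth[of v, symmetric]
  by (auto simp: smooth_vecs_def intro: domApowI)

text \<open>Compact spectral support makes every moment finite, bounded by K^2 R^(2k) times the mass
  of P^v. Such vectors serve as test vectors for limit functionals.\<close>

lemma bcalc_smooth:
  assumes h: "bounded_borel h" and R: "\<And>p. \<bar>p\<bar> > R \<Longrightarrow> h p = 0"
  shows "bcalc P h v \<in> smooth_vecs P"
  unfolding smooth_vecs_iff
proof
  fix k
  have [measurable]: "h \<in> borel_measurable borel" using h by (rule bounded_borel_measurable)
  obtain K where K: "\<And>p. cmod (h p) \<le> K" using h by (auto simp: bounded_borel_def)
  have "(\<integral>\<^sup>+p. ennreal (p ^ (2 * k)) \<partial>spec_meas P (bcalc P h v))
      = (\<integral>\<^sup>+p. ennreal ((cmod (h p))\<^sup>2) * ennreal (p ^ (2 * k)) \<partial>spec_meas P v)"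
    using nn_integral_spec_meas_fcalc[of h v] h
    by (simp add: fdom_bounded fcalc_bounded)
  also have "\<dots> \<le> (\<integral>\<^sup>+p. ennreal (K\<^sup>2 * R ^ (2 * k)) \<partial>spec_meas P v)"
  proof (intro nn_integral_mono)
    fix p
    have "(cmod (h p))\<^sup>2 * p ^ (2 * k) \<le> K\<^sup>2 * R ^ (2 * k)"
    proof (cases "\<bar>p\<bar> > R")
      case False
      then have "p ^ (2 * k) \<le> R ^ (2 * k)"
        using power_mono[of "\<bar>p\<bar>" R "2 * k"] by (simp add: power_even_abs)
      then show ?thesis
        by (intro mult_mono power_mono[OF K norm_ge_zero]) (auto simp: zero_le_power_eq)
    qed (auto simp: R zero_le_power_eq)
    then show "ennreal ((cmod (h p))\<^sup>2) * ennreal (p ^ (2 * k)) \<le> ennreal (K\<^sup>2 * R ^ (2 * k))"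
      by (subst ennreal_mult [symmetric]) (auto simp: zero_le_power_eq intro: ennreal_leI)
  qed
  also have "\<dots> < \<infinity>"
    by (simp add: emeasure_spec_meas_UNIV ennreal_mult_less_top)
  finally show "(\<integral>\<^sup>+p. ennreal (p ^ (2 * k)) \<partial>spec_meas P (bcalc P h v)) < \<infinity>" .
qed

lemma cinner_bcalc_fcalc:
  assumes f: "f \<in> borel_measurable borel" and v: "v \<in> fdom P f"
    and h: "bounded_borel h" and hf: "bounded_borel (\<lambda>p. cnj (h p) * f p)"
  shows "cinner (bcalc P h v) (fcalc P f v) = (\<integral>p. cnj (h p) * f p \<partial>spec_meas P v)"
  by (simp add: bcalc_adjoint h bcalc_fcalc[OF f v bounded_borel_cnj[OF h] hf]
      cinner_bcalc hf polarized_integral_self)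

section \<open>Fourier transform and reflection symmetry of the spectral measure\<close>

lemma cinner_Ugrp:
  "cinner v (Ugrp P t v) = (\<integral>p. exp (\<i> * complex_of_real (t * p)) \<partial>spec_meas P v)"
proof -
  have "bounded_borel (\<lambda>p. exp (\<i> * complex_of_real (t * p)))"
    by (rule bounded_borelI[where K = 1])
      (auto intro!: borel_measurable_continuous_onI continuous_intros)
  then show ?thesis
    by (simp add: Ugrp_def fcalc_bounded cinner_bcalc polarized_integral_self)
qed

text \<open>Since \<open>J\<close> is antilinear and commutes with \<open>U\<^sub>t\<close>, the Fourier transform
  \<open>\<langle>v, U\<^sub>t v\<rangle>\<close> of \<open>P\<^sup>v\<close> is real-valued.\<close>
lemma spec_meas_symmetric:
  assumes J: "antiunitary_involution J" and comm: "\<forall>t x. J (Ugrp P t x) = Ugrp P t (J x)"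
    and v: "J v = v"
  shows "distr (spec_meas P v) borel uminus = spec_meas P v"
proof -
  have vimage: "uminus -` E \<in> sets (borel :: real measure)" if "E \<in> sets borel" for E
    using measurable_sets[of uminus borel borel E] that by simp
  show ?thesis
  proof (cases "v = 0")
    case True
    have "norm (P E v) = 0" if "E \<in> sets borel" for E
      using P_diff[OF that, of 0 0] True by simp
    then show ?thesis
      by (intro measure_eqI) (auto simp: emeasure_distr emeasure_spec_meas vimage)
  next
    case False
    \<comment> \<open>Uniqueness of characteristic functions concerns probability measures; dividing
      by the mass (norm v)^2 reaches them, which is why v = 0 is treated separately.\<close>
    define c where "c = (norm v)\<^sup>2"
    have c: "c > 0" using False by (simp add: c_def)
    define M where "M = density (spec_meas P v) (\<lambda>_. ennreal (1 / c))"
    have emM: "emeasure M E = ennreal ((norm (P E v))\<^sup>2 / c)" if "E \<in> sets borel" for E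
      using that c unfolding M_def
      by (subst emeasure_density_const) (auto simp: emeasure_spec_meas ennreal_mult [symmetric])
    have sM [measurable_cong]: "sets M = sets borel" by (simp add: M_def)
    have spM: "space M = UNIV" by (simp add: M_def)
    interpret M: prob_space M
      by (rule prob_spaceI) (use c in \<open>simp add: spM emM P_UNIV c_def [symmetric]\<close>)
    have rM: "real_distribution M"
      by (rule real_distribution.intro[OF M.prob_space_axioms])
        (simp add: real_distribution_axioms_def sM spM)
    have rN: "real_distribution (distr M borel uminus)"
      by (rule M.real_distribution_distr) simp
    have char_M: "char M t = complex_of_real (1 / c) * cinner v (Ugrp P t v)" for t
      unfolding char_def M_def
      using c by (subst integral_density) (auto simp: cinner_Ugrp scaleR_conv_of_real)
    have "cinner (J v) (J (Ugrp P t v)) = cnj (cinner v (Ugrp P t v))" for t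
      using J by (simp add: antiunitary_involution_def)
    then have real: "cnj (cinner v (Ugrp P t v)) = cinner v (Ugrp P t v)" for t
      using comm v by simp
    have "char (distr M borel uminus) t = cnj (char M t)" for t
    proof -
      have "char (distr M borel uminus) t = (CLINT x|M. iexp (t * (- x)))"
        unfolding char_def by (subst integral_distr) auto
      also have "\<dots> = (CLINT x|M. cnj (iexp (t * x)))"
        by (intro Bochner_Integration.integral_cong) (auto simp: exp_cnj)
      finally show ?thesis by (simp add: char_def)
    qed
    then have "char (distr M borel uminus) = char M"
      by (simp add: fun_eq_iff char_M real)
    then have eq: "distr M borel uminus = M" by (rule Levy_uniqueness[OF rN rM])
    show ?thesis
    proof (rule measure_eqI)
      fix E assume "E \<in> sets (distr (spec_meas P v) borel uminus)"
      then have E: "E \<in> sets borel" by simp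
      have E': "uminus -` E \<in> sets borel" by (rule vimage[OF E])
      have "emeasure M (uminus -` E) = emeasure M E"
        using E arg_cong[OF eq, of "\<lambda>N. emeasure N E"] by (simp add: emeasure_distr spM)
      then have "(norm (P (uminus -` E) v))\<^sup>2 = (norm (P E v))\<^sup>2"
        using c by (simp add: emM E E' ennreal_inj)
      then show "emeasure (distr (spec_meas P v) borel uminus) E = emeasure (spec_meas P v) E"
        using E E' by (simp add: emeasure_distr emeasure_spec_meas)
    qed simp
  qed
qed

end

section \<open>Exponential moments\<close>

text \<open>Absorbing the density into the integrand leaves one nonnegative integral over \<mu>, so
  later estimates are pointwise comparisons of weights.\<close>

lemma tempered_density_exp_iff:
  assumes [measurable_cong]: "sets \<mu> = sets borel"
  shows "tempered (density \<mu> (\<lambda>p. ennreal (exp (pi * p))))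
    \<longleftrightarrow> (\<exists>N. (\<integral>\<^sup>+p. ennreal (exp (pi * p) / (1 + p\<^sup>2) ^ N) \<partial>\<mu>) < \<infinity>)"
proof -
  have "(\<integral>\<^sup>+p. ennreal ((1 + p\<^sup>2) powr (- real N)) \<partial>density \<mu> (\<lambda>p. ennreal (exp (pi * p))))
      = (\<integral>\<^sup>+p. ennreal (exp (pi * p) / (1 + p\<^sup>2) ^ N) \<partial>\<mu>)" for N :: nat
  proof -
    have "1 + p\<^sup>2 > 0" for p :: real by (intro add_pos_nonneg) auto
    then have "ennreal (exp (pi * p)) * ennreal ((1 + p\<^sup>2) powr (- real N))
        = ennreal (exp (pi * p) / (1 + p\<^sup>2) ^ N)" for p :: real
      by (subst ennreal_mult [symmetric]) (simp_all add: powr_minus powr_realpow divide_inverse)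
    then show ?thesis by (subst nn_integral_density) auto
  qed
  then show ?thesis by (simp add: tempered_def)
qed

text \<open>A majorant independent of t, valid up to and including the endpoints: the sum dominates
  e^(pi |p|).\<close>

lemma exp_le_exp_pi_sum:
  assumes "\<bar>t\<bar> \<le> pi / 2"
  shows "exp (2 * t * p) \<le> exp (pi * p) + exp (- (pi * p))"
proof -
  have "2 * t * p \<le> pi * \<bar>p\<bar>"
    using mult_right_mono[of "2 * \<bar>t\<bar>" pi "\<bar>p\<bar>"] abs_ge_self[of "2 * t * p"] assms
    by (simp add: abs_mult)
  then have "exp (2 * t * p) \<le> exp (pi * \<bar>p\<bar>)" by simp
  also have "\<dots> \<le> exp (pi * p) + exp (- (pi * p))"
    by (cases "p \<ge> 0") (simp_all add: abs_if)
  finally show ?thesis .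
qed

lemma nn_integral_symmetric:
  assumes s [measurable_cong]: "sets \<mu> = sets borel" and sym: "distr \<mu> borel uminus = \<mu>"
    and [measurable]: "g \<in> borel_measurable borel"
  shows "(\<integral>\<^sup>+p. g (- p) \<partial>\<mu>) = (\<integral>\<^sup>+p. g (p::real) \<partial>\<mu>)"
proof -
  have "(\<integral>\<^sup>+p. g p \<partial>distr \<mu> borel uminus) = (\<integral>\<^sup>+p. g (- p) \<partial>\<mu>)"
    by (rule nn_integral_distr) auto
  then show ?thesis by (simp add: sym)
qed

lemma tempered_symmetric:
  assumes s [measurable_cong]: "sets \<mu> = sets borel" and sym: "distr \<mu> borel uminus = \<mu>"
    and fin: "(\<integral>\<^sup>+p. ennreal (exp (pi * p) / (1 + p\<^sup>2) ^ N) \<partial>\<mu>) < \<infinity>"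
  shows "(\<integral>\<^sup>+p. ennreal ((exp (pi * p) + exp (- (pi * p))) / (1 + p\<^sup>2) ^ N) \<partial>\<mu>) < \<infinity>"
proof -
  have "(\<integral>\<^sup>+p. ennreal ((exp (pi * p) + exp (- (pi * p))) / (1 + p\<^sup>2) ^ N) \<partial>\<mu>)
      = (\<integral>\<^sup>+p. ennreal (exp (pi * p) / (1 + p\<^sup>2) ^ N)
          + ennreal (exp (pi * (- p)) / (1 + (- p)\<^sup>2) ^ N) \<partial>\<mu>)"
    by (intro nn_integral_cong) (simp add: add_divide_distrib)
  also have "\<dots> = 2 * (\<integral>\<^sup>+p. ennreal (exp (pi * p) / (1 + p\<^sup>2) ^ N) \<partial>\<mu>)"
    by (subst nn_integral_add)
      (use nn_integral_symmetric[OF s sym, of "\<lambda>p. ennreal (exp (pi * p) / (1 + p\<^sup>2) ^ N)"] in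
        \<open>simp_all add: mult_2\<close>)
  also have "\<dots> < \<infinity>" using fin by (simp add: ennreal_mult_less_top)
  finally show ?thesis .
qed

text \<open>With d = pi/2 - |t| one has e^(2tp) <= e^(pi |p|) e^(-2 d |p|), and the second factor
  beats (1 + p^2)^n at the price of a constant times d^(-2n). This gives the growth exponent
  2n.\<close>

lemma tempered_imp_growth:
  assumes s [measurable_cong]: "sets \<mu> = sets borel"
    and fin: "(\<integral>\<^sup>+p. ennreal ((exp (pi * p) + exp (- (pi * p))) / (1 + p\<^sup>2) ^ N) \<partial>\<mu>) < \<infinity>"
  shows "\<exists>C M. C > 0 \<and> M > 0 \<and> (\<forall>t. \<bar>t\<bar> < pi / 2 \<longrightarrow>
    (\<integral>\<^sup>+p. ennreal (exp (2 * t * p)) \<partial>\<mu>) \<le> ennreal (C * (pi / 2 - \<bar>t\<bar>) powr (- M)))"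
proof -
  \<comment> \<open>The successor keeps n positive, for the division by n and for a positive growth
    exponent; enlarging the power only lowers the weight.\<close>
  define n where "n = Suc N"
  have n0: "real n > 0" by (simp add: n_def)
  define w where "w p = (exp (pi * p) + exp (- (pi * p))) / (1 + p\<^sup>2) ^ n" for p
  have "(\<integral>\<^sup>+p. ennreal (w p) \<partial>\<mu>) \<le>
      (\<integral>\<^sup>+p. ennreal ((exp (pi * p) + exp (- (pi * p))) / (1 + p\<^sup>2) ^ N) \<partial>\<mu>)"
    unfolding w_def n_def
    by (intro nn_integral_mono ennreal_leI divide_left_mono power_increasing mult_pos_pos
        zero_less_power add_nonneg_nonneg) (auto intro: add_pos_nonneg)
  also note fin
  finally obtain I where I: "I \<ge> 0" "(\<integral>\<^sup>+p. ennreal (w p) \<partial>\<mu>) = ennreal I"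
    by (cases "(\<integral>\<^sup>+p. ennreal (w p) \<partial>\<mu>)") auto
  \<comment> \<open>From 2 + y <= 2 n e^(y/n), raised to the power 2n.\<close>
  define K where "K = (2 * real n) ^ (2 * n)"
  have K: "K > 0" by (simp add: K_def n_def)
  have w0: "w p \<ge> 0" for p by (simp add: w_def add_nonneg_nonneg)
  have pw: "exp (2 * t * p) \<le> K * (pi / 2 - \<bar>t\<bar>) powr (- (2 * real n)) * w p"
    if t: "\<bar>t\<bar> < pi / 2" for t p
  proof -
    define d where "d = pi / 2 - \<bar>t\<bar>"
    have d: "0 < d" "d \<le> 2" using t pi_less_4 by (auto simp: d_def)
    \<comment> \<open>In the variable y = d |p| the estimate no longer depends on the scale d; the
      bound d <= 2, from pi < 4, absorbs the summand d^2.\<close>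
    define y where "y = d * \<bar>p\<bar>"
    have y: "0 \<le> y" using d by (simp add: y_def)
    have "(1 + p\<^sup>2) * d\<^sup>2 = d\<^sup>2 + y\<^sup>2" by (simp add: y_def power_mult_distrib algebra_simps)
    also have "d\<^sup>2 \<le> 2\<^sup>2" using d by (intro power_mono) auto
    also have "2\<^sup>2 + y\<^sup>2 \<le> (2 + y)\<^sup>2" using y by (simp add: power2_sum)
    finally have "(1 + p\<^sup>2) * d\<^sup>2 \<le> (2 + y)\<^sup>2" by simp
    then have "((1 + p\<^sup>2) * d\<^sup>2) ^ n \<le> ((2 + y)\<^sup>2) ^ n"
      by (intro power_mono) auto
    also have "\<dots> = (2 + y) ^ (2 * n)" by (simp add: power_mult)
    also have "\<dots> \<le> (2 * real n * exp (y / real n)) ^ (2 * n)"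
    proof (intro power_mono)
      have "2 + y \<le> 2 * real n * (1 + y / real n)"
        using y by (simp add: n_def field_simps)
      also have "\<dots> \<le> 2 * real n * exp (y / real n)"
        by (intro mult_left_mono exp_ge_add_one_self) auto
      finally show "2 + y \<le> 2 * real n * exp (y / real n)" .
    qed (use y in auto)
    also have "\<dots> = K * exp (y / real n) ^ (2 * n)"
      by (simp only: K_def power_mult_distrib)
    also have "exp (y / real n) ^ (2 * n) = exp (real (2 * n) * (y / real n))"
      by (rule exp_of_nat_mult [symmetric])
    also have "real (2 * n) * (y / real n) = 2 * y"
      using n0 by simp
    finally have *: "(1 + p\<^sup>2) ^ n * d ^ (2 * n) \<le> K * exp (2 * y)"
      by (simp add: power_mult_distrib power_mult)
    have "2 * t * p \<le> 2 * \<bar>t\<bar> * \<bar>p\<bar>"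
      using abs_ge_self[of "2 * t * p"] by (simp add: abs_mult)
    also have "\<dots> = pi * \<bar>p\<bar> - 2 * y" by (simp add: y_def d_def algebra_simps)
    finally have "exp (2 * t * p) * exp (2 * y) \<le> exp (pi * \<bar>p\<bar>)"
      by (simp add: exp_add [symmetric])
    also have "\<dots> \<le> exp (pi * p) + exp (- (pi * p))"
      by (cases "p \<ge> 0") (simp_all add: abs_if)
    finally have **: "exp (2 * t * p) * exp (2 * y) \<le> exp (pi * p) + exp (- (pi * p))" .
    have "exp (2 * t * p) * ((1 + p\<^sup>2) ^ n * d ^ (2 * n)) \<le> exp (2 * t * p) * (K * exp (2 * y))"
      by (intro mult_left_mono *) auto
    also have "\<dots> = K * (exp (2 * t * p) * exp (2 * y))" by simp
    also have "\<dots> \<le> K * (exp (pi * p) + exp (- (pi * p)))"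
      using K by (intro mult_left_mono **) auto
    finally have "exp (2 * t * p) * ((1 + p\<^sup>2) ^ n * d ^ (2 * n))
        \<le> K * (exp (pi * p) + exp (- (pi * p)))" .
    moreover have "(1 + p\<^sup>2) ^ n > 0" by (intro zero_less_power add_pos_nonneg) auto
    moreover have "d ^ (2 * n) > 0" using d by simp
    ultimately have "exp (2 * t * p) \<le> K * (1 / d ^ (2 * n)) * w p"
      by (simp add: w_def field_simps)
    moreover have "d powr (- (2 * real n)) = 1 / d ^ (2 * n)"
      using powr_realpow[of d "2 * n"] d by (simp add: powr_minus divide_inverse)
    ultimately show ?thesis by (simp only: d_def [symmetric])
  qed
  have "(\<integral>\<^sup>+p. ennreal (exp (2 * t * p)) \<partial>\<mu>)
      \<le> ennreal (K * (I + 1) * (pi / 2 - \<bar>t\<bar>) powr (- (2 * real n)))" if t: "\<bar>t\<bar> < pi / 2" for t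
  proof -
    define k where "k = K * (pi / 2 - \<bar>t\<bar>) powr (- (2 * real n))"
    have k: "k \<ge> 0" using K by (simp add: k_def)
    have "(\<integral>\<^sup>+p. ennreal (exp (2 * t * p)) \<partial>\<mu>) \<le> (\<integral>\<^sup>+p. ennreal k * ennreal (w p) \<partial>\<mu>)"
      using pw[OF t] k w0
      by (intro nn_integral_mono) (simp add: ennreal_mult [symmetric] k_def ennreal_leI)
    also have "\<dots> = ennreal (k * I)"
      using k I by (subst nn_integral_cmult) (auto simp: w_def ennreal_mult)
    also have "\<dots> \<le> ennreal (K * (I + 1) * (pi / 2 - \<bar>t\<bar>) powr (- (2 * real n)))"
      using k by (intro ennreal_leI) (simp add: k_def algebra_simps)
    finally show ?thesis .
  qed
  \<comment> \<open>I may vanish, so I + 1 ensures a strictly positive constant.\<close>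
  moreover have "K * (I + 1) > 0" "2 * real n > 0" using K I by (auto simp: n_def)
  ultimately show ?thesis by blast
qed

text \<open>At \<open>t = \<pi>/2 - 1/n\<close> with \<open>n = \<lfloor>p\<rfloor> + 1\<close>, the weight \<open>e\<^bsup>2tp\<^esup>\<close> agrees with \<open>e\<^bsup>\<pi>p\<^esup>\<close> up to a
  factor \<open>e\<^sup>2\<close>; summing the growth estimate over these \<open>t\<close> with weights \<open>n\<^bsup>-L-2\<^esup>\<close> dominates the
  density.\<close>
lemma growth_imp_tempered:
  assumes s [measurable_cong]: "sets \<mu> = sets borel" and fin: "emeasure \<mu> UNIV < \<infinity>"
    and growth: "\<And>t. \<bar>t\<bar> < pi / 2 \<Longrightarrow>
      (\<integral>\<^sup>+p. ennreal (exp (2 * t * p)) \<partial>\<mu>) \<le> ennreal (C * (pi / 2 - \<bar>t\<bar>) powr (- M))"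
    and C: "C > 0"
  shows "\<exists>N. (\<integral>\<^sup>+p. ennreal (exp (pi * p) / (1 + p\<^sup>2) ^ N) \<partial>\<mu>) < \<infinity>"
proof -
  obtain L :: nat where L: "M \<le> real L" using real_arch_simple by blast
  define N where "N = L + 2"
  \<comment> \<open>Indexing by \<open>Suc n\<close> starts at pi/2 - 1 > 0, so all
    \<open>t n\<close> are positive and their distance to the endpoint is exactly 1 / real (Suc
    n).\<close>
  define t where "t n = pi / 2 - 1 / real (Suc n)" for n
  have t: "\<bar>t n\<bar> < pi / 2" "pi / 2 - \<bar>t n\<bar> = 1 / real (Suc n)" for n
  proof -
    have "0 < 1 / real (Suc n)" "1 / real (Suc n) \<le> 1" by (auto simp: field_simps)
    then have "0 < t n" "t n < pi / 2" using pi_gt3 unfolding t_def by linarith+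
    then show "\<bar>t n\<bar> < pi / 2" "pi / 2 - \<bar>t n\<bar> = 1 / real (Suc n)" by (auto simp: t_def)
  qed
  define g where "g n p = 1 / real (Suc n) ^ N * exp (2 * t n * p)" for n p
  \<comment> \<open>With r = floor(p) + 1, the factor e^2 compensates the loss 2p/r <= 2 in the
    exponent, and 2^N the comparison r <= 2 (1 + p^2).\<close>
  define K :: real where "K = exp 2 * 2 ^ N"
  have [measurable]: "g n \<in> borel_measurable borel" for n unfolding g_def by measurable
  have int_g: "(\<integral>\<^sup>+p. ennreal (g n p) \<partial>\<mu>) \<le> ennreal (C * (1 / real (Suc n) ^ 2))" for n
  proof -
    have "(\<integral>\<^sup>+p. ennreal (g n p) \<partial>\<mu>)
        = ennreal (1 / real (Suc n) ^ N) * (\<integral>\<^sup>+p. ennreal (exp (2 * t n * p)) \<partial>\<mu>)"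
      unfolding g_def
      by (subst nn_integral_cmult [symmetric])
        (auto simp: ennreal_mult [symmetric] simp del: of_nat_Suc)
    also have "\<dots> \<le> ennreal (1 / real (Suc n) ^ N) * ennreal (C * real (Suc n) ^ L)"
    proof (intro mult_left_mono)
      have "(\<integral>\<^sup>+p. ennreal (exp (2 * t n * p)) \<partial>\<mu>) \<le> ennreal (C * (1 / real (Suc n)) powr (- M))"
        using growth[OF t(1)[of n]] t(2)[of n] by simp
      also have "(1 / real (Suc n)) powr (- M) = real (Suc n) powr M"
        by (simp add: powr_divide powr_minus field_simps)
      also have "ennreal (C * real (Suc n) powr M) \<le> ennreal (C * real (Suc n) powr (real L))"
        using C L by (intro ennreal_leI mult_left_mono powr_mono) auto
      finally show "(\<integral>\<^sup>+p. ennreal (exp (2 * t n * p)) \<partial>\<mu>) \<le> ennreal (C * real (Suc n) ^ L)"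
        by (simp only: powr_realpow of_nat_0_less_iff zero_less_Suc)
    qed auto
    also have "\<dots> = ennreal (C * (1 / real (Suc n) ^ 2))"
      using C by (subst ennreal_mult [symmetric])
        (simp_all add: N_def power_add power2_eq_square del: of_nat_Suc)
    finally show ?thesis .
  qed
  have pw: "ennreal (exp (pi * p) / (1 + p\<^sup>2) ^ N) \<le> 1 + ennreal K * (\<Sum>n. ennreal (g n p))" for p
  proof (cases "p < 0")
    \<comment> \<open>On the left half-line the weight is at most 1, which the summand 1 covers
      thanks to the finite mass of \<mu>.\<close>
    case True
    have "(1::real) \<le> (1 + p\<^sup>2) ^ N" by (intro one_le_power) simp
    moreover have "exp (pi * p) \<le> 1" using True by (simp add: mult_le_0_iff)
    ultimately have "exp (pi * p) / (1 + p\<^sup>2) ^ N \<le> 1"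
      using frac_le[of 1 "exp (pi * p)" 1 "(1 + p\<^sup>2) ^ N"] by simp
    then have "ennreal (exp (pi * p) / (1 + p\<^sup>2) ^ N) \<le> 1"
      by (simp add: ennreal_le_1)
    then show ?thesis by (rule order_trans) simp
  next
    case False
    \<comment> \<open>The index is floor(p) itself because \<open>g\<close> and \<open>t\<close>
      count from 0; then p < r <= p + 1.\<close>
    define n where "n = nat \<lfloor>p\<rfloor>"
    define r where "r = real (Suc n)"
    have n: "p < r" "r \<le> p + 1" using False by (auto simp: n_def r_def) linarith+
    have r: "r > 0" by (simp add: r_def)
    have "r \<le> 2 * (1 + p\<^sup>2)"
    proof -
      have "2 * p \<le> p\<^sup>2 + 1" using sum_squares_bound[of p 1] by simp
      moreover have "0 \<le> p\<^sup>2" by simp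
      ultimately show ?thesis using n by argo
    qed
    then have "r ^ N \<le> (2 * (1 + p\<^sup>2)) ^ N" using r by (intro power_mono) auto
    then have "r ^ N \<le> 2 ^ N * (1 + p\<^sup>2) ^ N" by (simp only: power_mult_distrib)
    moreover have "(1 + p\<^sup>2) ^ N > 0" by (intro zero_less_power add_pos_nonneg) auto
    moreover have "r ^ N > 0" using r by simp
    ultimately have 1: "1 / (1 + p\<^sup>2) ^ N \<le> 2 ^ N * (1 / r ^ N)"
      by (simp add: field_simps)
    have "pi * p \<le> 2 + 2 * t n * p"
    proof -
      have "p / r \<le> 1" using n r by simp
      moreover have "2 * t n * p = pi * p - 2 * (p / r)"
        by (simp add: t_def r_def left_diff_distrib)
      ultimately show ?thesis by linarith
    qed
    then have 2: "exp (pi * p) \<le> exp 2 * exp (2 * t n * p)"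
      by (simp add: exp_add [symmetric])
    have "exp (pi * p) * (1 / (1 + p\<^sup>2) ^ N) \<le> (exp 2 * exp (2 * t n * p)) * (2 ^ N * (1 / r ^ N))"
      by (intro mult_mono 1 2) auto
    then have "ennreal (exp (pi * p) / (1 + p\<^sup>2) ^ N) \<le> ennreal (K * g n p)"
      by (intro ennreal_leI) (simp add: K_def g_def r_def mult_ac)
    also have "\<dots> = ennreal K * ennreal (g n p)"
      by (intro ennreal_mult) (auto simp: K_def g_def)
    also have "\<dots> \<le> ennreal K * (\<Sum>n. ennreal (g n p))"
      using sum_le_suminf[of "\<lambda>n. ennreal (g n p)" "{n}"] by (intro mult_left_mono) auto
    also have "\<dots> \<le> 1 + ennreal K * (\<Sum>n. ennreal (g n p))" by simp
    finally show ?thesis .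
  qed
  have "(\<integral>\<^sup>+p. ennreal (exp (pi * p) / (1 + p\<^sup>2) ^ N) \<partial>\<mu>)
      \<le> (\<integral>\<^sup>+p. 1 + ennreal K * (\<Sum>n. ennreal (g n p)) \<partial>\<mu>)"
    by (intro nn_integral_mono pw)
  also have "\<dots> = emeasure \<mu> (space \<mu>) + ennreal K * (\<Sum>n. \<integral>\<^sup>+p. ennreal (g n p) \<partial>\<mu>)"
    by (simp add: nn_integral_add nn_integral_cmult nn_integral_suminf)
  also have "(\<Sum>n. \<integral>\<^sup>+p. ennreal (g n p) \<partial>\<mu>) \<le> (\<Sum>n. ennreal (C * (1 / real (Suc n) ^ 2)))"
    by (intro suminf_le int_g) auto
  also have "\<dots> = ennreal (\<Sum>n. C * (1 / real (Suc n) ^ 2))"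
  proof (rule suminf_ennreal2)
    have "summable (\<lambda>n. 1 / real (Suc n) ^ 2)"
      using inverse_power_summable[of 2, where 'a = real]
      by (subst summable_Suc_iff [where f = "\<lambda>n. 1 / real n ^ 2"]) (simp add: divide_inverse)
    then show "summable (\<lambda>n. C * (1 / real (Suc n) ^ 2))" by (rule summable_mult)
  qed (use C in auto)
  finally have "(\<integral>\<^sup>+p. ennreal (exp (pi * p) / (1 + p\<^sup>2) ^ N) \<partial>\<mu>)
      \<le> emeasure \<mu> (space \<mu>) + ennreal K * ennreal (\<Sum>n. C * (1 / real (Suc n) ^ 2))"
    by (simp add: add_left_mono mult_left_mono)
  also have "\<dots> < \<infinity>"
    using fin sets_eq_imp_space_eq[OF s] by (simp add: ennreal_mult_less_top)
  finally show ?thesis ..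
qed

section \<open>Distributional boundary values\<close>

lemma bounded_borel_of_real:
  assumes "f \<in> borel_measurable borel" "\<And>p. \<bar>f p\<bar> \<le> K"
  shows "bounded_borel (\<lambda>p. complex_of_real (f p))"
  using assms by (intro bounded_borelI[where K = K]) auto

text \<open>One limit lemma within the open interval then covers both endpoints, and approximating
  sequences stay where v lies in the domain.\<close>

lemma at_within_pi_half:
  "at (pi / 2) within {- (pi / 2)<..<pi / 2} = at_left (pi / 2)"
  "at (- (pi / 2)) within {- (pi / 2)<..<pi / 2} = at_right (- (pi / 2))"
proof -
  show "at (pi / 2) within {- (pi / 2)<..<pi / 2} = at_left (pi / 2)"
    by (rule at_within_nhd[where S = "{0<..}"]) (auto intro: less_trans[of _ 0])
  show "at (- (pi / 2)) within {- (pi / 2)<..<pi / 2} = at_right (- (pi / 2))"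
    by (rule at_within_nhd[where S = "{..<0}"]) (auto intro: less_trans[of _ 0])
qed

context pvm
begin

lemma expA_measurable: "(\<lambda>p. complex_of_real (exp (t * p))) \<in> borel_measurable borel"
  by measurable

lemma norm_expA:
  assumes "v \<in> dom_expA P t"
  shows "ennreal ((norm (expA P t v))\<^sup>2) = (\<integral>\<^sup>+p. ennreal (exp (2 * t * p)) \<partial>spec_meas P v)"
proof -
  have "(cmod (complex_of_real (exp (t * p))))\<^sup>2 = exp (2 * t * p)" for p
    by (simp add: power2_eq_square exp_add [symmetric])
  then show ?thesis
    using norm_fcalc[OF expA_measurable, of v t] assms by (simp add: expA_def dom_expA_def)
qed

text \<open>This makes (1 + A^2)^N continuous on smooth vectors: (1 + p^2)^(2N) <= 2^(2N) (1 +
  p^(4N)), and the right-hand side integrates to a multiple of the squared norms of w and A^(2N)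
  w.\<close>

lemma smooth_in_fdom_power:
  fixes N :: nat
  assumes w: "w \<in> smooth_vecs P"
  defines "k \<equiv> (\<lambda>p. complex_of_real ((1 + p\<^sup>2) ^ N))"
  shows "w \<in> fdom P k"
    and "norm (fcalc P k w) \<le> 2 ^ (2 * N + 1) * (\<Sum>j\<le>2 * N. norm ((opA P ^^ j) w))"
proof -
  define m where "m = 2 * N"
  have [measurable]: "k \<in> borel_measurable borel" unfolding k_def by measurable
  have pw: "(cmod (k p))\<^sup>2 \<le> 2 ^ m * (1 + p ^ (2 * m))" for p
  proof -
    have "(cmod (k p))\<^sup>2 = (1 + p\<^sup>2) ^ m"
      by (simp add: k_def m_def norm_power power_mult [symmetric] mult.commute
          del: of_real_add of_real_power)
    also have "\<dots> \<le> (2 * max 1 (p\<^sup>2)) ^ m" by (intro power_mono) auto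
    also have "\<dots> = 2 ^ m * max 1 (p\<^sup>2) ^ m" by (simp add: power_mult_distrib)
    also have "max 1 (p\<^sup>2) ^ m \<le> 1 + p ^ (2 * m)"
      by (simp add: max_def power_mult zero_le_power)
    finally show ?thesis by simp
  qed
  define S where "S = (\<Sum>j\<le>2 * N. norm ((opA P ^^ j) w))"
  have S: "norm w \<le> S" "norm ((opA P ^^ m) w) \<le> S"
    using member_le_sum[of 0 "{..2 * N}" "\<lambda>j. norm ((opA P ^^ j) w)"]
      member_le_sum[of m "{..2 * N}" "\<lambda>j. norm ((opA P ^^ j) w)"]
    by (auto simp: S_def m_def)
  have S0: "S \<ge> 0" using S(1) norm_ge_zero order_trans by blast
  have "(\<integral>\<^sup>+p. ennreal ((cmod (k p))\<^sup>2) \<partial>spec_meas P w)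
      \<le> (\<integral>\<^sup>+p. ennreal (2 ^ m) * (1 + ennreal (p ^ (2 * m))) \<partial>spec_meas P w)"
  proof (intro nn_integral_mono)
    fix p
    have "ennreal ((cmod (k p))\<^sup>2) \<le> ennreal (2 ^ m * (1 + p ^ (2 * m)))"
      by (intro ennreal_leI pw)
    also have "\<dots> = ennreal (2 ^ m) * (1 + ennreal (p ^ (2 * m)))"
      by (subst ennreal_mult) (simp_all add: zero_le_power_eq ennreal_plus)
    finally show "ennreal ((cmod (k p))\<^sup>2) \<le> ennreal (2 ^ m) * (1 + ennreal (p ^ (2 * m)))" .
  qed
  also have "\<dots> = ennreal (2 ^ m) * (ennreal ((norm w)\<^sup>2) + ennreal ((norm ((opA P ^^ m) w))\<^sup>2))"
    by (simp add: nn_integral_cmult nn_integral_add emeasure_spec_meas_UNIV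
        norm_opA_power_smooth[OF w])
  also have "\<dots> = ennreal (2 ^ m * ((norm w)\<^sup>2 + (norm ((opA P ^^ m) w))\<^sup>2))"
    by (simp add: ennreal_mult)
  finally have le: "(\<integral>\<^sup>+p. ennreal ((cmod (k p))\<^sup>2) \<partial>spec_meas P w)
      \<le> ennreal (2 ^ m * ((norm w)\<^sup>2 + (norm ((opA P ^^ m) w))\<^sup>2))" .
  also have "\<dots> < \<infinity>" by simp
  finally show dom: "w \<in> fdom P k" by (simp add: fdom_def)
  have "ennreal ((norm (fcalc P k w))\<^sup>2)
      \<le> ennreal (2 ^ m * ((norm w)\<^sup>2 + (norm ((opA P ^^ m) w))\<^sup>2))"
    using le by (subst norm_fcalc[OF _ dom]) auto
  then have "(norm (fcalc P k w))\<^sup>2 \<le> 2 ^ m * ((norm w)\<^sup>2 + (norm ((opA P ^^ m) w))\<^sup>2)"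
    by (subst (asm) ennreal_le_iff) auto
  also have "\<dots> \<le> 2 ^ m * (S\<^sup>2 + S\<^sup>2)"
    by (intro mult_left_mono add_mono power_mono S) auto
  also have "\<dots> = 2 ^ (m + 1) * S\<^sup>2" by simp
  \<comment> \<open>Squaring the constant is wasteful but leaves a perfect square, so no square root
    enters the final bound.\<close>
  also have "\<dots> \<le> (2 ^ (m + 1))\<^sup>2 * S\<^sup>2"
    by (intro mult_right_mono self_le_power one_le_power) auto
  also have "\<dots> = (2 ^ (m + 1) * S)\<^sup>2" by (simp only: power_mult_distrib)
  finally show "norm (fcalc P k w) \<le> 2 ^ (2 * N + 1) * (\<Sum>j\<le>2 * N. norm ((opA P ^^ j) w))"
    unfolding m_def S_def [symmetric] by (rule power2_le_imp_le) (simp add: S0)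
qed

text \<open>With \<open>h(p) = (1 + p\<^sup>2)\<^bsup>-N\<^esup>\<close>, a smooth \<open>w\<close> is \<open>h(A) (1 + A\<^sup>2)\<^sup>N w\<close>, and
  \<open>h(A) e\<^bsup>tA\<^esup> v\<close> converges in norm by dominated convergence.\<close>
lemma distr_limit_expA:
  assumes vdom: "\<And>t. \<bar>t\<bar> < pi / 2 \<Longrightarrow> v \<in> dom_expA P t"
    and fin: "(\<integral>\<^sup>+p. ennreal ((exp (pi * p) + exp (- (pi * p))) / (1 + p\<^sup>2) ^ N) \<partial>spec_meas P v) < \<infinity>"
    and c: "\<bar>c\<bar> \<le> pi / 2"
    and F: "F = at c within {- (pi / 2)<..<pi / 2}" "F \<noteq> bot"
  shows "distr_limit P (\<lambda>t. expA P t v) F"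
proof -
  define W where "W p = (exp (pi * p) + exp (- (pi * p))) / (1 + p\<^sup>2) ^ N" for p
  define hr where "hr p = 1 / (1 + p\<^sup>2) ^ N" for p :: real
  define h where "h p = complex_of_real (hr p)" for p
  define g where "g p = complex_of_real (hr p * exp (c * p))" for p
  define k where "k = (\<lambda>p. complex_of_real ((1 + p\<^sup>2) ^ N))"
  define y where "y = fcalc P g v"
  have [measurable]: "hr \<in> borel_measurable borel" "W \<in> borel_measurable borel"
    "h \<in> borel_measurable borel" "g \<in> borel_measurable borel" "k \<in> borel_measurable borel"
    unfolding hr_def [abs_def] W_def [abs_def] h_def [abs_def] g_def [abs_def] k_def by measurable
  have one: "(1 + p\<^sup>2) ^ N \<ge> 1" for p :: real by (intro one_le_power) simp
  have hr: "0 < hr p" "hr p \<le> 1" for p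
  proof -
    show "0 < hr p" unfolding hr_def using one[of p] by (intro divide_pos_pos) linarith+
    show "hr p \<le> 1" unfolding hr_def using one[of p] by (subst divide_le_eq_1_pos) linarith+
  qed
  have bh: "bounded_borel h"
    unfolding h_def [abs_def] using hr
    by (intro bounded_borel_of_real[where K = 1]) (auto simp: abs_of_pos)
  have hk: "h p * k p = 1" for p
  proof -
    have "(1 + p\<^sup>2) ^ N \<noteq> 0" using one[of p] by linarith
    then have "hr p * (1 + p\<^sup>2) ^ N = 1"
      unfolding hr_def times_divide_eq_left mult_1_left by (rule divide_self)
    then show ?thesis
      by (simp only: h_def k_def of_real_mult [symmetric] of_real_1)
  qed
  have sq: "(hr p * exp (t * p))\<^sup>2 \<le> W p" if "\<bar>t\<bar> \<le> pi / 2" for t p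
  proof -
    have "(hr p * exp (t * p))\<^sup>2 = hr p * (hr p * exp (2 * t * p))"
      by (simp add: power2_eq_square exp_add [symmetric] mult_ac)
    \<comment> \<open>One factor \<open>hr p\<close> is estimated by 1; the other one becomes the
      tempered weight.\<close>
    also have "\<dots> \<le> 1 * (hr p * (exp (pi * p) + exp (- (pi * p))))"
      using hr[of p] exp_le_exp_pi_sum[OF that, of p] by (intro mult_mono) auto
    finally show ?thesis by (simp add: W_def hr_def)
  qed
  have vg: "v \<in> fdom P g"
  proof -
    have "(\<integral>\<^sup>+p. ennreal ((cmod (g p))\<^sup>2) \<partial>spec_meas P v) \<le> (\<integral>\<^sup>+p. ennreal (W p) \<partial>spec_meas P v)"
      using sq[OF c] by (intro nn_integral_mono ennreal_leI) (simp add: g_def del: of_real_mult)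
    also have "\<dots> < \<infinity>" using fin by (simp add: W_def)
    finally show ?thesis by (simp add: fdom_def)
  qed
  have conv: "((\<lambda>t. bcalc P h (expA P t v)) \<longlongrightarrow> y) F"
    unfolding F(1) tendsto_at_iff_sequentially comp_def
  proof (intro allI impI)
    fix X :: "nat \<Rightarrow> real"
    assume X: "\<forall>i. X i \<in> {- (pi / 2)<..<pi / 2} - {c}" "X \<longlonglongrightarrow> c"
    have Xi: "\<bar>X i\<bar> < pi / 2" for i using X(1)[rule_format, of i] by auto
    define d where "d i p = (cmod (h p * complex_of_real (exp (X i * p)) - g p))\<^sup>2" for i p
    have [measurable]: "d i \<in> borel_measurable borel" for i
      unfolding d_def [abs_def] by measurable
    have norm_eq: "ennreal ((norm (bcalc P h (expA P (X i) v) - y))\<^sup>2)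
        = (\<integral>\<^sup>+p. ennreal (d i p) \<partial>spec_meas P v)" for i
    proof -
      have dom: "v \<in> fdom P (\<lambda>p. complex_of_real (exp (X i * p)))"
        using vdom[OF Xi] by (simp add: dom_expA_def)
      have "spec_meas P (bcalc P h (expA P (X i) v) - y)
          = density (spec_meas P v) (\<lambda>p. ennreal (d i p))"
        unfolding expA_def y_def d_def
        by (rule spec_meas_bcalc_fcalc_diff[OF expA_measurable dom _ vg bh]) simp
      then have "emeasure (spec_meas P (bcalc P h (expA P (X i) v) - y)) UNIV
          = emeasure (density (spec_meas P v) (\<lambda>p. ennreal (d i p))) UNIV" by simp
      then show ?thesis
        by (simp add: emeasure_spec_meas_UNIV emeasure_density)
    qed
    \<comment> \<open>For nonnegative a and b, |a - b| <= max a b, so W itself dominates.\<close>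
    have d_le: "d i p \<le> W p" for i p
    proof -
      define a where "a = hr p * exp (X i * p)"
      define b where "b = hr p * exp (c * p)"
      have ab: "0 \<le> a" "0 \<le> b" using hr[of p] by (auto simp: a_def b_def)
      have "d i p = (a - b)\<^sup>2"
        unfolding d_def h_def g_def a_def b_def
        by (simp only: of_real_mult [symmetric] of_real_diff [symmetric] norm_of_real power2_abs)
      also have "\<dots> \<le> (max a b)\<^sup>2"
        using ab by (intro abs_le_square_iff [THEN iffD1]) auto
      also have "\<dots> \<le> W p"
        using sq[of "X i" p] sq[OF c, of p] Xi[of i] by (simp add: max_def a_def b_def)
      finally show ?thesis .
    qed
    have "(\<lambda>i. \<integral>\<^sup>+p. ennreal (d i p) \<partial>spec_meas P v) \<longlonglongrightarrow> (\<integral>\<^sup>+p. 0 \<partial>spec_meas P v)"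
    proof (rule nn_integral_dominated_convergence[where w = "\<lambda>p. ennreal (W p)"])
      show "AE p in spec_meas P v. (\<lambda>i. ennreal (d i p)) \<longlonglongrightarrow> 0"
      proof (rule AE_I2)
        fix p
        have "(\<lambda>i. d i p) \<longlonglongrightarrow> (cmod (h p * complex_of_real (exp (c * p)) - g p))\<^sup>2"
          unfolding d_def by (intro tendsto_intros X(2))
        also have "h p * complex_of_real (exp (c * p)) - g p = 0" by (simp add: h_def g_def)
        finally have "(\<lambda>i. ennreal (d i p)) \<longlonglongrightarrow> ennreal ((cmod 0)\<^sup>2)"
          by (rule tendsto_ennrealI)
        then show "(\<lambda>i. ennreal (d i p)) \<longlonglongrightarrow> 0" by simp
      qed
    qed (use d_le fin in \<open>auto simp: W_def intro!: ennreal_leI\<close>)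
    then have "(\<lambda>i. ennreal ((norm (bcalc P h (expA P (X i) v) - y))\<^sup>2)) \<longlonglongrightarrow> ennreal 0"
      by (simp add: norm_eq)
    then have "(\<lambda>i. (norm (bcalc P h (expA P (X i) v) - y))\<^sup>2) \<longlonglongrightarrow> 0"
      by (subst (asm) tendsto_ennreal_iff) auto
    then have "(\<lambda>i. sqrt ((norm (bcalc P h (expA P (X i) v) - y))\<^sup>2)) \<longlonglongrightarrow> sqrt 0"
      by (rule tendsto_real_sqrt)
    then show "(\<lambda>i. bcalc P h (expA P (X i) v)) \<longlonglongrightarrow> y"
      by (simp add: LIM_zero_iff tendsto_norm_zero_iff)
  qed
  define \<psi> where "\<psi> w = cinner (fcalc P k w) y" for w
  have lim: "((\<lambda>t. cinner w (expA P t v)) \<longlongrightarrow> \<psi> w) F" if w: "w \<in> smooth_vecs P" for w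
  proof -
    have "bcalc P h (fcalc P k w) = w"
      using smooth_in_fdom_power(1)[OF w, of N, folded k_def]
      by (subst bcalc_fcalc) (simp_all add: bh hk bounded_borel_const bcalc_one)
    then have "cinner w (expA P t v) = cinner (fcalc P k w) (bcalc P h (expA P t v))" for t
      using bcalc_adjoint[OF bh, of "fcalc P k w" "expA P t v"]
      by (simp add: h_def [abs_def])
    then show ?thesis unfolding \<psi>_def by (simp add: tendsto_cinner_right conv)
  qed
  \<comment> \<open>Defined as a limit on all vectors, not as \<psi>: sums and multiples of smooth
    vectors then take their values from limits of inner products, so neither linearity of
    \<open>fcalc P k\<close> nor closure of \<open>smooth_vecs P\<close> has to be shown.\<close>
  define \<phi> where "\<phi> w = Lim F (\<lambda>t. cinner w (expA P t v))" for w
  have eq: "\<phi> w = \<psi> w" if "w \<in> smooth_vecs P" for w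
    unfolding \<phi>_def by (rule tendsto_Lim[OF F(2) lim[OF that]])
  have "\<phi> \<in> distr_vecs P"
    unfolding distr_vecs_def mem_Collect_eq
  proof (intro conjI ballI allI)
    fix x z assume x: "x \<in> smooth_vecs P" "z \<in> smooth_vecs P"
    have "((\<lambda>t. cinner (x + z) (expA P t v)) \<longlongrightarrow> \<psi> x + \<psi> z) F"
      unfolding cinner_add_left by (intro tendsto_add lim x)
    then show "\<phi> (x + z) = \<phi> x + \<phi> z"
      using x by (simp add: eq) (simp add: \<phi>_def tendsto_Lim[OF F(2)])
  next
    fix a x assume x: "x \<in> smooth_vecs P"
    have "((\<lambda>t. cinner (scaleC a x) (expA P t v)) \<longlongrightarrow> cnj a * \<psi> x) F"
      unfolding cinner_scaleC_left by (intro tendsto_mult tendsto_const lim x)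
    then show "\<phi> (scaleC a x) = cnj a * \<phi> x"
      using x by (simp add: eq) (simp add: \<phi>_def tendsto_Lim[OF F(2)])
  next
    have "cmod (\<phi> x) \<le> 2 ^ (2 * N + 1) * norm y * (\<Sum>j\<le>2 * N. norm ((opA P ^^ j) x))"
      if x: "x \<in> smooth_vecs P" for x
    proof -
      have "cmod (\<phi> x) \<le> norm (fcalc P k x) * norm y"
        unfolding eq[OF x] \<psi>_def by (rule cinner_cauchy_schwarz)
      also have "\<dots> \<le> 2 ^ (2 * N + 1) * (\<Sum>j\<le>2 * N. norm ((opA P ^^ j) x)) * norm y"
        unfolding k_def by (intro mult_right_mono smooth_in_fdom_power(2) x) auto
      finally show ?thesis by (simp only: mult_ac)
    qed
    then show "\<exists>n C. \<forall>x\<in>smooth_vecs P. cmod (\<phi> x) \<le> C * (\<Sum>k\<le>n. norm ((opA P ^^ k) x))"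
      by blast
  qed
  then show ?thesis
    unfolding distr_limit_def using lim eq by (intro bexI[of _ \<phi>]) auto
qed

text \<open>Tested against \<open>w = 1\<^bsub>[-R,R]\<^esub>(A) e\<^bsup>\<pi>A/2\<^esup> (1 + A\<^sup>2)\<^bsup>-n\<^esup> v\<close>, the limit functional takes the value
  \<open>I = \<integral>\<^bsub>[-R,R]\<^esub> e\<^bsup>\<pi>p\<^esup> (1 + p\<^sup>2)\<^bsup>-n\<^esup> dP\<^sup>v\<close>, while the seminorms of \<open>w\<close> are at most \<open>\<surd>I\<close>; continuity
  of the functional hence bounds \<open>I\<close> independently of \<open>R\<close>.\<close>
lemma distr_limit_imp_tempered:
  assumes vdom: "\<And>t. \<bar>t\<bar> < pi / 2 \<Longrightarrow> v \<in> dom_expA P t"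
    and lim: "distr_limit P (\<lambda>t. expA P t v) (at_left (pi / 2))"
  shows "\<exists>n. (\<integral>\<^sup>+p. ennreal (exp (pi * p) / (1 + p\<^sup>2) ^ n) \<partial>spec_meas P v) < \<infinity>"
proof -
  from lim obtain \<phi> n C where
    \<phi>: "\<And>w. w \<in> smooth_vecs P \<Longrightarrow> ((\<lambda>t. cinner w (expA P t v)) \<longlongrightarrow> \<phi> w) (at_left (pi / 2))"
    and bnd: "\<And>x. x \<in> smooth_vecs P \<Longrightarrow> cmod (\<phi> x) \<le> C * (\<Sum>k\<le>n. norm ((opA P ^^ k) x))"
    unfolding distr_limit_def distr_vecs_def by blast
  \<comment> \<open>The power n is the order of the functional, so that (1 + p^2)^n absorbs p^(2k)
    for every seminorm with k <= n. In \<open>B\<close> the factor \<open>Suc n\<close> counts these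
    seminorms; the absolute value is taken since C is an arbitrary real.\<close>
  define q where "q p = exp (pi * p) / (1 + p\<^sup>2) ^ n" for p
  define B where "B = \<bar>C\<bar> * real (Suc n)"
  have [measurable]: "q \<in> borel_measurable borel" unfolding q_def [abs_def] by measurable
  have one: "(1 + p\<^sup>2) ^ n \<ge> 1" for p :: real by (intro one_le_power) simp
  have key: "(\<integral>\<^sup>+p. ennreal (q p) * indicator {- R..R} p \<partial>spec_meas P v) \<le> ennreal (B\<^sup>2)"
    if R: "R \<ge> 0" for R :: real
  proof -
    define hr where "hr p = indicator {- R..R} p * exp (pi / 2 * p) / (1 + p\<^sup>2) ^ n" for p
    define h where "h p = complex_of_real (hr p)" for p
    define w where "w = bcalc P h v"
    have [measurable]: "hr \<in> borel_measurable borel" unfolding hr_def [abs_def] by measurable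
    have exp_le: "exp (t * p) \<le> exp (pi / 2 * R)" if "\<bar>p\<bar> \<le> R" "\<bar>t\<bar> \<le> pi / 2" for t p
      using mult_mono[of "\<bar>t\<bar>" "pi / 2" "\<bar>p\<bar>" R] that abs_ge_self[of "t * p"]
      by (simp add: abs_mult)
    have hr0: "0 \<le> hr p" for p using one[of p] by (simp add: hr_def)
    \<comment> \<open>A bound uniform in t up to the endpoint: it dominates the integrals along X
      and makes h(A) e^(tA) a bounded calculus.\<close>
    have hr_exp: "hr p * exp (t * p) \<le> exp (pi / 2 * R) * exp (pi / 2 * R)"
      if "\<bar>t\<bar> \<le> pi / 2" for t p
    proof (cases "\<bar>p\<bar> \<le> R")
      case True
      have "hr p \<le> exp (pi / 2 * p) / 1"
        unfolding hr_def using one[of p] by (intro frac_le) (auto simp: indicator_def)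
      also have "\<dots> \<le> exp (pi / 2 * R)" using exp_le[OF True, of "pi / 2"] by simp
      finally show ?thesis by (intro mult_mono exp_le True that) auto
    qed (auto simp: hr_def indicator_def)
    have bh: "bounded_borel h"
      unfolding h_def [abs_def] using hr0 hr_exp[of 0]
      by (intro bounded_borel_of_real[where K = "exp (pi / 2 * R) * exp (pi / 2 * R)"]) auto
    have w: "w \<in> smooth_vecs P"
      unfolding w_def by (rule bcalc_smooth[OF bh, of R]) (auto simp: h_def hr_def indicator_def)
    have bhe: "bounded_borel (\<lambda>p. complex_of_real (hr p * exp (t * p)))"
      if "\<bar>t\<bar> \<le> pi / 2" for t
      using hr0 hr_exp[OF that]
      by (intro bounded_borel_of_real[where K = "exp (pi / 2 * R) * exp (pi / 2 * R)"])
        auto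
    have cin: "cinner w (expA P t v) = (\<integral>p. complex_of_real (hr p * exp (t * p)) \<partial>spec_meas P v)"
      if t: "\<bar>t\<bar> < pi / 2" for t
      unfolding w_def expA_def
      using cinner_bcalc_fcalc[OF expA_measurable, of v t h] vdom[OF t] bhe[of t] bh t
      by (simp add: dom_expA_def h_def)
    define I where "I = (\<integral>p. hr p * exp (pi / 2 * p) \<partial>spec_meas P v)"
    have hq: "hr p * exp (pi / 2 * p) = q p * indicator {- R..R} p" for p
      by (simp add: hr_def q_def exp_add [symmetric])
    have "\<phi> w = complex_of_real I"
    proof (rule LIMSEQ_unique)
      define X where "X i = pi / 2 - 1 / real (Suc i)" for i
      have Xi: "\<bar>X i\<bar> < pi / 2" for i
      proof -
        have "0 < 1 / real (Suc i)" "1 / real (Suc i) \<le> 1" by (auto simp: field_simps)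
        then show ?thesis using pi_gt3 unfolding X_def by linarith
      qed
      have X: "X \<longlonglongrightarrow> pi / 2"
        unfolding X_def using tendsto_diff[OF tendsto_const LIMSEQ_Suc[OF lim_1_over_n]] by simp
      moreover have "X i < pi / 2" for i by (simp add: X_def)
      ultimately have "filterlim X (at_left (pi / 2)) sequentially"
        by (intro filterlim_at_withinI always_eventually) (simp_all add: less_imp_neq)
      then show "(\<lambda>i. cinner w (expA P (X i) v)) \<longlonglongrightarrow> \<phi> w"
        by (rule filterlim_compose[OF \<phi>[OF w]])
      have "(\<lambda>i. \<integral>p. complex_of_real (hr p * exp (X i * p)) \<partial>spec_meas P v)
          \<longlonglongrightarrow> (\<integral>p. complex_of_real (hr p * exp (pi / 2 * p)) \<partial>spec_meas P v)"
      proof (rule integral_bounded_lim[where K = "exp (pi / 2 * R) * exp (pi / 2 * R)"])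
        show "cmod (complex_of_real (hr p * exp (X i * p))) \<le> exp (pi / 2 * R) * exp (pi / 2 * R)"
          for i p
          unfolding norm_of_real using hr_exp[of "X i" p] Xi[of i] hr0[of p] by (simp add: abs_mult)
        show "(\<lambda>i. complex_of_real (hr p * exp (X i * p)))
            \<longlonglongrightarrow> complex_of_real (hr p * exp (pi / 2 * p))" for p
          by (intro tendsto_intros X)
      qed measurable
      then show "(\<lambda>i. cinner w (expA P (X i) v)) \<longlonglongrightarrow> complex_of_real I"
        unfolding integral_complex_of_real I_def by (simp only: cin Xi integral_complex_of_real)
    qed
    have "integrable (spec_meas P v) (\<lambda>p. complex_of_real (hr p * exp (pi / 2 * p)))"
      by (intro integrable_bounded_borel bhe) simp
    then have "integrable (spec_meas P v) (\<lambda>p. hr p * exp (pi / 2 * p))"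
      by (simp only: complex_of_real_integrable_eq)
    then have I: "(\<integral>\<^sup>+p. ennreal (hr p * exp (pi / 2 * p)) \<partial>spec_meas P v) = ennreal I"
      unfolding I_def using hr0 by (intro nn_integral_eq_integral) auto
    have I0: "0 \<le> I" unfolding I_def using hr0 by (intro integral_nonneg_AE) auto
    have "norm ((opA P ^^ k) w) \<le> sqrt I" if k: "k \<le> n" for k
    proof -
      have "ennreal ((norm ((opA P ^^ k) w))\<^sup>2)
          = (\<integral>\<^sup>+p. ennreal ((cmod (h p))\<^sup>2) * ennreal (p ^ (2 * k)) \<partial>spec_meas P v)"
        using norm_opA_power_smooth[OF w, of k]
          nn_integral_spec_meas_fcalc[OF bounded_borel_measurable[OF bh] fdom_bounded[OF bh],
            of "\<lambda>p. ennreal (p ^ (2 * k))" v]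
        by (simp add: w_def fcalc_bounded[OF bh])
      also have "\<dots> \<le> (\<integral>\<^sup>+p. ennreal (hr p * exp (pi / 2 * p)) \<partial>spec_meas P v)"
      proof (intro nn_integral_mono)
        fix p :: real
        \<comment> \<open>Only one of the two factors \<open>hr p\<close> meets the polynomial, and
          the product is at most e^(pi p/2); what remains is the integrand of I.\<close>
        have "p ^ (2 * k) \<le> (1 + p\<^sup>2) ^ n"
        proof -
          have "p ^ (2 * k) \<le> (1 + p\<^sup>2) ^ k" unfolding power_mult by (intro power_mono) auto
          also have "\<dots> \<le> (1 + p\<^sup>2) ^ n" using k by (intro power_increasing) auto
          finally show ?thesis .
        qed
        then have "hr p * p ^ (2 * k) \<le> hr p * (1 + p\<^sup>2) ^ n"
          by (rule mult_left_mono) (rule hr0)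
        also have "\<dots> = indicator {- R..R} p * exp (pi / 2 * p)"
        proof -
          have "(1 + p\<^sup>2) ^ n \<noteq> 0" using one[of p] by linarith
          then show ?thesis unfolding hr_def by (rule nonzero_eq_divide_eq [THEN iffD1]) (rule refl)
        qed
        also have "\<dots> \<le> exp (pi / 2 * p)" by (simp add: indicator_def)
        finally have "hr p * (hr p * p ^ (2 * k)) \<le> hr p * exp (pi / 2 * p)"
          by (intro mult_left_mono hr0)
        then show "ennreal ((cmod (h p))\<^sup>2) * ennreal (p ^ (2 * k)) \<le> ennreal (hr p * exp (pi / 2 * p))"
          by (subst ennreal_mult [symmetric])
            (auto simp: h_def power2_eq_square mult.assoc zero_le_power_eq intro!: ennreal_leI)
      qed
      finally have "ennreal ((norm ((opA P ^^ k) w))\<^sup>2) \<le> ennreal I" unfolding I .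
      then have "(norm ((opA P ^^ k) w))\<^sup>2 \<le> I" using I0 by simp
      then show ?thesis by (rule real_le_rsqrt)
    qed
    then have "(\<Sum>k\<le>n. norm ((opA P ^^ k) w)) \<le> real (Suc n) * sqrt I"
      using sum_bounded_above[of "{..n}" "\<lambda>k. norm ((opA P ^^ k) w)" "sqrt I"] by simp
    moreover have "0 \<le> (\<Sum>k\<le>n. norm ((opA P ^^ k) w))" by (intro sum_nonneg) auto
    ultimately have "C * (\<Sum>k\<le>n. norm ((opA P ^^ k) w)) \<le> \<bar>C\<bar> * (real (Suc n) * sqrt I)"
      by (intro mult_mono) auto
    \<comment> \<open>I is bounded by a multiple of its own square root and is finite because of the
      cut-off, so \<open>sqrt I\<close> can be divided out.\<close>
    then have "I \<le> B * sqrt I"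
      using bnd[OF w] I0 \<open>\<phi> w = complex_of_real I\<close> by (simp add: B_def mult.assoc)
    then have "sqrt I * sqrt I \<le> B * sqrt I" using I0 by simp
    then have "sqrt I \<le> B"
      using I0 by (cases "I = 0") (simp add: B_def, subst (asm) mult_le_cancel_right_pos, simp)
    then have "(sqrt I)\<^sup>2 \<le> B\<^sup>2" using I0 by (intro power_mono) auto
    then have "I \<le> B\<^sup>2" using I0 by simp
    moreover have "(\<integral>\<^sup>+p. ennreal (q p) * indicator {- R..R} p \<partial>spec_meas P v) = ennreal I"
      unfolding I [symmetric] hq by (intro nn_integral_cong) (auto simp: indicator_def)
    ultimately show ?thesis by (simp add: ennreal_leI)
  qed
  \<comment> \<open>Since B does not depend on R, continuity from below of the measure with density
    q turns the bounds on [-R, R] into a global one.\<close>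
  define D where "D = density (spec_meas P v) (\<lambda>p. ennreal (q p))"
  have emD: "emeasure D E = (\<integral>\<^sup>+p. ennreal (q p) * indicator E p \<partial>spec_meas P v)"
    if "E \<in> sets borel" for E
    unfolding D_def using that by (subst emeasure_density) auto
  have "(\<Union>i::nat. {- real i..real i}) = UNIV"
  proof safe
    fix p :: real
    obtain i where "\<bar>p\<bar> \<le> real i" using real_arch_simple by blast
    then show "p \<in> (\<Union>i::nat. {- real i..real i})" by (intro UN_I[of i]) auto
  qed auto
  then have "emeasure D UNIV = (SUP i. emeasure D {- real i..real i})"
    using SUP_emeasure_incseq[of "\<lambda>i. {- real i..real i}" D]
    by (auto simp: D_def incseq_def image_subset_iff)
  also have "\<dots> \<le> ennreal (B\<^sup>2)"
    by (intro SUP_least) (simp add: emD key)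
  finally have "(\<integral>\<^sup>+p. ennreal (q p) \<partial>spec_meas P v) \<le> ennreal (B\<^sup>2)"
    by (simp add: emD)
  also have "\<dots> < \<infinity>" by simp
  finally show ?thesis unfolding q_def by blast
qed

end

theorem mainTheorem16:
  fixes P :: "real set \<Rightarrow> 'a::chilbert \<Rightarrow> 'a"
    and J :: "'a \<Rightarrow> 'a"
    and v :: 'a
  assumes pvm: "is_pvm P"
    and J_au: "antiunitary_involution J"
    and J_comm: "\<forall>t x. J (Ugrp P t x) = Ugrp P t (J x)"
    and vJ: "J v = v"
    and vdom: "\<forall>t. \<bar>t\<bar> < pi / 2 \<longrightarrow> v \<in> dom_expA P t"
  shows "(v \<in> HJ_temp P J
            \<longleftrightarrow> distr_limit P (\<lambda>t. expA P t v) (at_left (pi / 2))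
                \<and> distr_limit P (\<lambda>t. expA P t v) (at_right (- pi / 2)))
       \<and> (v \<in> HJ_temp P J
            \<longleftrightarrow> (\<exists>C N. C > 0 \<and> N > 0 \<and>
                   (\<forall>t. \<bar>t\<bar> < pi / 2 \<longrightarrow>
                      (norm (expA P t v))\<^sup>2 \<le> C * (pi / 2 - \<bar>t\<bar>) powr (- N) \<and>
                      (norm (expA P (- t) v))\<^sup>2 \<le> C * (pi / 2 - \<bar>t\<bar>) powr (- N))))"
    (is "(?a \<longleftrightarrow> ?b) \<and> (?a \<longleftrightarrow> ?c)")
proof -
  interpret pvm P by (rule pvm.intro[OF pvm])
  let ?\<mu> = "spec_meas P v"
  have dom: "v \<in> dom_expA P t" if "\<bar>t\<bar> < pi / 2" for t using vdom that by blast
  have a_iff: "?a \<longleftrightarrow> (\<exists>N. (\<integral>\<^sup>+p. ennreal (exp (pi * p) / (1 + p\<^sup>2) ^ N) \<partial>?\<mu>) < \<infinity>)"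
    using vJ by (simp add: HJ_temp_def tempered_density_exp_iff)
  note sym = spec_meas_symmetric[OF J_au J_comm vJ]
  have sym_temp: "\<exists>N. (\<integral>\<^sup>+p. ennreal ((exp (pi * p) + exp (- (pi * p))) / (1 + p\<^sup>2) ^ N) \<partial>?\<mu>) < \<infinity>"
    if ?a
    using that tempered_symmetric[OF sets_spec_meas sym] unfolding a_iff by blast
  have "?b" if a: ?a
  proof -
    from sym_temp[OF a] obtain N where
      N: "(\<integral>\<^sup>+p. ennreal ((exp (pi * p) + exp (- (pi * p))) / (1 + p\<^sup>2) ^ N) \<partial>?\<mu>) < \<infinity>" ..
    show ?b
      using distr_limit_expA[OF dom N, of "pi / 2" "at_left (pi / 2)"]
        distr_limit_expA[OF dom N, of "- (pi / 2)" "at_right (- (pi / 2))"]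
      by (simp add: at_within_pi_half)
  qed
  moreover have "?a" if b: ?b
    unfolding a_iff using b by (intro distr_limit_imp_tempered dom) auto
  moreover have "?c" if a: ?a
  proof -
    from sym_temp[OF a] obtain N where
      N: "(\<integral>\<^sup>+p. ennreal ((exp (pi * p) + exp (- (pi * p))) / (1 + p\<^sup>2) ^ N) \<partial>?\<mu>) < \<infinity>" ..
    from tempered_imp_growth[OF sets_spec_meas N] obtain C M where
      C: "C > 0" "M > 0" and bnd: "\<And>t. \<bar>t\<bar> < pi / 2 \<Longrightarrow>
        (\<integral>\<^sup>+p. ennreal (exp (2 * t * p)) \<partial>?\<mu>) \<le> ennreal (C * (pi / 2 - \<bar>t\<bar>) powr (- M))"
      by blast
    have "(norm (expA P t v))\<^sup>2 \<le> C * (pi / 2 - \<bar>t\<bar>) powr (- M)" if t: "\<bar>t\<bar> < pi / 2" for t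
    proof -
      have "0 \<le> C * (pi / 2 - \<bar>t\<bar>) powr (- M)" using C by simp
      then show ?thesis
        using bnd[OF t] unfolding norm_expA[OF dom[OF t], symmetric] by (simp only: ennreal_le_iff)
    qed
    \<comment> \<open>The bound depends on |t| only, so the estimate for e^(-tA) is the one at
      -t.\<close>
    from this this[of "- t" for t] show ?c using C by (metis abs_minus_cancel)
  qed
  moreover have "?a" if c: ?c
  proof -
    from c obtain C M where C: "C > 0" and bnd: "\<And>t. \<bar>t\<bar> < pi / 2 \<Longrightarrow>
        (norm (expA P t v))\<^sup>2 \<le> C * (pi / 2 - \<bar>t\<bar>) powr (- M)"
      by blast
    show ?a unfolding a_iff
    proof (rule growth_imp_tempered[OF sets_spec_meas _ _ C])
      show "emeasure ?\<mu> UNIV < \<infinity>" by (simp add: emeasure_spec_meas_UNIV)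
      show "(\<integral>\<^sup>+p. ennreal (exp (2 * t * p)) \<partial>?\<mu>) \<le> ennreal (C * (pi / 2 - \<bar>t\<bar>) powr (- M))"
        if t: "\<bar>t\<bar> < pi / 2" for t
        unfolding norm_expA[OF dom[OF t], symmetric] by (intro ennreal_leI bnd t)
    qed
  qed
  ultimately show ?thesis by blast
qed

end
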